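(* Assume $F$ is dyadic. Let $\underline{a}=(a_1,\ldots,a_n)\in\mathbb{Z}_{\geq 0}^n$ be a non-decreasing sequence. Let $B=(b_{ij})\in\mathcal{H}_n(\mathfrak{o})$ and $T=(t_{ij})\in\mathcal{H}_n(\mathfrak{o})$ be reduced forms with standard GK types $(\underline{a},\sigma_1)$ and $(\underline{a},\sigma_2)$, respectively. If $B\sim T$, then $\sigma_1=\sigma_2$.
   Context: $F$ is a non-archimedean local field of characteristic $0$ with ring of integers $\mathfrak{o}$, maximal ideal $\mathfrak{p}$, $q=[\mathfrak{o}:\mathfrak{p}]$, a fixed prime element $\varpi$ and normalized valuation $\mathrm{ord}$ ($\mathrm{ord}(0)=+\infty$); $F$ is dyadic if $q$ is even. $\mathcal{H}_n(\mathfrak{o})$ is the set of symmetric $B=(b_{ij})\in\mathrm{M}_n(F)$ with $b_{ii}\in\mathfrak{o}$ and $2b_{ij}\in\mathfrak{o}$. For $X\in\mathrm{GL}_n(F)$, $B[X]={}^tXBX$; $B\sim B'$ means $B'=B[U]$ for some $U\in\mathrm{GL}_n(\mathfrak{o})$. For $\underline{a}\in\mathbb{Z}^n$, $\mathcal{M}(\underline{a})=\{B\in\mathcal{H}_n(\mathfrak{o}) : \mathrm{ord}(b_{ii})\ge a_i,\ \mathrm{ord}(2b_{ij})\ge (a_i+a_j)/2\ (i<j)\}$. The Gross–Keating invariant $\mathrm{GK}(B)$ of nondegenerate $B$ is the lexicographically greatest non-decreasing $\underline{b}\in\mathbb{Z}_{\ge0}^n$ such that $B[U]\in\mathcal{M}(\underline{b})$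 for some $U\in\mathrm{GL}_n(\mathfrak{o})$. Blocks: $I_1,\ldots,I_r$ are the sets of indices $i$ with $a_i$ equal to the 1st, 2nd, ..., $r$-th smallest distinct value among the $a_j$. For an involution $\sigma\in\mathfrak{S}_n$ put $\mathcal{P}^0=\{i:\sigma(i)=i\}$, $\mathcal{P}^+=\{i:a_i>a_{\sigma(i)}\}$, $\mathcal{P}^-=\{i:a_i<a_{\sigma(i)}\}$, and $\mathcal{P}^{0}_s,\mathcal{P}^{\pm}_s$ their intersections with $I_s$. $\sigma$ is $\underline{a}$-admissible if: (i) $\mathcal{P}^0$ has at most two elements; if it has two distinct elements $i,j$ then $a_i\not\equiv a_j \bmod 2$; and if $i\in\mathcal{P}^0$ then $a_i=\max\{a_j : j\in\mathcal{P}^0\cup\mathcal{P}^+,\ a_j\equiv a_i \bmod 2\}$; (ii) $\sharp\mathcal{P}^+_s\le 1$ and $\sharp\mathcal{P}^-_s+\sharp\mathcal{P}^0_s\le 1$ for all $s$; (iii) if $i\in\mathcal{P}^-$ then $a_{\sigma(i)}=\min\{a_j : j\in\mathcal{P}^+,\ a_j>a_i,\ a_j\equiv a_i\bmod 2\}$, and if $i\in\mathcal{P}^+$ then $a_{\sigma(i)}=\max\{a_j : j\in\mathcal{P}^-,\ a_j<a_i,\ a_j\equiv a_i \bmod 2\}$. The pair $(\underline{a},\sigma)$ is a GK type. It is standard if moreover: $i\in\mathcal{P}^0_s\cup\mathcal{P}^-_s$ implies $i$ is the maximal element of $I_s$; $i\in\mathcal{P}^+_s$ implies $i$ is the minimal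 element of $I_s$; and $a_i=a_{\sigma(i)}$ implies $|\sigma(i)-i|\le 1$. $B=(b_{ij})\in\mathcal{M}(\underline{a})$ is a reduced form of GK type $(\underline{a},\sigma)$ if: (1) if $i\notin\mathcal{P}^0$, $j=\sigma(i)$ and $a_i\le a_j$, then $\mathrm{GK}\begin{pmatrix} b_{ii}&b_{ij}\\ b_{ij}&b_{jj}\end{pmatrix}=(a_i,a_j)$; (2) if $i\in\mathcal{P}^0$ then $\mathrm{ord}(b_{ii})=a_i$; (3) if $j\ne i,\sigma(i)$ then $\mathrm{ord}(2b_{ij})>(a_i+a_j)/2$. *)

theory Defs
  imports
    "HOL-Library.Extended_Real"
    "HOL-Combinatorics.Permutations"
    "Jordan_Normal_Form.Determinant"
begin

section \<open>Non-archimedean local fields of characteristic 0\<close>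

text \<open>The normalized valuation takes the value \<open>\<infinity>\<close> at \<open>0\<close> and integer values elsewhere; it is
  normalized since \<open>1\<close> is attained (at the prime elements).\<close>

class discretely_valued_field = field_char_0 +
  fixes vord :: "'a \<Rightarrow> ereal"
  assumes vord_zero: "vord 0 = \<infinity>"
    and vord_int: "x \<noteq> 0 \<Longrightarrow> \<exists>k::int. vord x = ereal (of_int k)"
    and vord_mult: "vord (x * y) = vord x + vord y"
    and vord_add: "min (vord x) (vord y) \<le> vord (x + y)"
    and vord_normalized: "\<exists>x. vord x = 1"

definition (in discretely_valued_field) valuation_ring :: "'a set" where
  "valuation_ring = {x. vord x \<ge> 0}"

definition (in discretely_valued_field) maximal_ideal :: "'a set" where
  "maximal_ideal = {x. vord x > 0}"

definition (in discretely_valued_field) residue_field :: "'a set set" where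
  "residue_field =
     valuation_ring // {(x, y). x \<in> valuation_ring \<and> y \<in> valuation_ring \<and> x - y \<in> maximal_ideal}"

definition (in discretely_valued_field) vord_Cauchy :: "(nat \<Rightarrow> 'a) \<Rightarrow> bool" where
  "vord_Cauchy X \<longleftrightarrow> (\<forall>N::int. \<exists>K. \<forall>k\<ge>K. \<forall>l\<ge>K. vord (X k - X l) \<ge> ereal (of_int N))"

definition (in discretely_valued_field) vord_converges_to :: "(nat \<Rightarrow> 'a) \<Rightarrow> 'a \<Rightarrow> bool" where
  "vord_converges_to X x \<longleftrightarrow> (\<forall>N::int. \<exists>K. \<forall>k\<ge>K. vord (X k - x) \<ge> ereal (of_int N))"

class nonarch_local_field = discretely_valued_field +
  assumes vord_complete: "vord_Cauchy X \<Longrightarrow> \<exists>x. vord_converges_to X x"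
    and finite_residue_field: "finite residue_field"

definition dyadic :: "'a::nonarch_local_field itself \<Rightarrow> bool" where
  "dyadic _ \<longleftrightarrow> even (card (residue_field :: 'a set set))"

section \<open>Half-integral symmetric matrices\<close>

text \<open>Matrix rows and columns, list positions and permutations are all indexed by \<open>{..<n}\<close>.\<close>

definition integral_mats :: "nat \<Rightarrow> 'a::nonarch_local_field mat set" where
  "integral_mats n = {U \<in> carrier_mat n n. \<forall>i<n. \<forall>j<n. U $$ (i, j) \<in> valuation_ring}"

definition GL_o :: "nat \<Rightarrow> 'a::nonarch_local_field mat set" where
  "GL_o n = {U \<in> integral_mats n. \<exists>V \<in> integral_mats n. U * V = 1\<^sub>m n \<and> V * U = 1\<^sub>m n}"

definition half_integral :: "nat \<Rightarrow> 'a::nonarch_local_field mat set" where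
  "half_integral n = {B \<in> carrier_mat n n. transpose_mat B = B \<and>
     (\<forall>i<n. B $$ (i, i) \<in> valuation_ring) \<and>
     (\<forall>i<n. \<forall>j<n. 2 * B $$ (i, j) \<in> valuation_ring)}"

text \<open>\<open>form_act B X\<close> is \<open>B[X]\<close>, and \<open>form_equiv\<close> is the relation \<open>B \<sim> B'\<close>.\<close>

definition form_act :: "'a::nonarch_local_field mat \<Rightarrow> 'a mat \<Rightarrow> 'a mat" where
  "form_act B X = transpose_mat X * B * X"

definition form_equiv :: "'a::nonarch_local_field mat \<Rightarrow> 'a mat \<Rightarrow> bool" where
  "form_equiv B B' \<longleftrightarrow> (\<exists>U \<in> GL_o (dim_row B). B' = form_act B U)"

text \<open>\<open>M_set a\<close> is \<open>\<M>(a)\<close>, with \<open>n = length a\<close>.\<close>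

definition M_set :: "int list \<Rightarrow> 'a::nonarch_local_field mat set" where
  "M_set a = {B \<in> half_integral (length a).
     (\<forall>i<length a. vord (B $$ (i, i)) \<ge> ereal (of_int (a ! i))) \<and>
     (\<forall>i j. i < j \<and> j < length a \<longrightarrow>
        vord (2 * B $$ (i, j)) \<ge> ereal (of_int (a ! i + a ! j) / 2))}"

section \<open>The Gross--Keating invariant\<close>

definition GK_candidates :: "'a::nonarch_local_field mat \<Rightarrow> int list set" where
  "GK_candidates B = {b. length b = dim_row B \<and> sorted b \<and> (\<forall>x \<in> set b. 0 \<le> x) \<and>
     (\<exists>U \<in> GL_o (dim_row B). form_act B U \<in> M_set b)}"

text \<open>\<open>is_GK B b\<close> says that \<open>GK(B)\<close> is defined (that is, \<open>B\<close> is a nondegenerate half-integral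
  matrix) and equal to \<open>b\<close>. It is a relation, so that no value is assigned to a degenerate \<open>B\<close>.
  All candidates have the same length, so \<^const>\<open>lexord\<close> compares them lexicographically.\<close>

definition is_GK :: "'a::nonarch_local_field mat \<Rightarrow> int list \<Rightarrow> bool" where
  "is_GK B b \<longleftrightarrow> B \<in> half_integral (dim_row B) \<and> det B \<noteq> 0 \<and> b \<in> GK_candidates B \<and>
     (\<forall>c \<in> GK_candidates B. c = b \<or> (c, b) \<in> lexord {(x, y). x < y})"

section \<open>GK types\<close>

text \<open>The blocks \<open>I\<^sub>1, \<dots>, I\<^sub>r\<close> are \<open>block a s\<close> for \<open>s < r = card (set a)\<close>.\<close>

definition block :: "int list \<Rightarrow> nat \<Rightarrow> nat set" where
  "block a s = {i. i < length a \<and> a ! i = sorted_list_of_set (set a) ! s}"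

definition P_zero :: "int list \<Rightarrow> (nat \<Rightarrow> nat) \<Rightarrow> nat set" where
  "P_zero a \<sigma> = {i. i < length a \<and> \<sigma> i = i}"

definition P_plus :: "int list \<Rightarrow> (nat \<Rightarrow> nat) \<Rightarrow> nat set" where
  "P_plus a \<sigma> = {i. i < length a \<and> a ! i > a ! \<sigma> i}"

definition P_minus :: "int list \<Rightarrow> (nat \<Rightarrow> nat) \<Rightarrow> nat set" where
  "P_minus a \<sigma> = {i. i < length a \<and> a ! i < a ! \<sigma> i}"

text \<open>In \<open>admissible_iii\<close> an extremum over the empty set does not exist, so an equation with it
  fails; this has to be said explicitly, because \<^const>\<open>Min\<close> and \<^const>\<open>Max\<close> are total.\<close>

definition admissible_i :: "int list \<Rightarrow> (nat \<Rightarrow> nat) \<Rightarrow> bool" where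
  "admissible_i a \<sigma> \<longleftrightarrow> card (P_zero a \<sigma>) \<le> 2 \<and>
     (\<forall>i \<in> P_zero a \<sigma>. \<forall>j \<in> P_zero a \<sigma>. i \<noteq> j \<longrightarrow> a ! i mod 2 \<noteq> a ! j mod 2) \<and>
     (\<forall>i \<in> P_zero a \<sigma>.
        a ! i = Max {a ! j |j. j \<in> P_zero a \<sigma> \<union> P_plus a \<sigma> \<and> a ! j mod 2 = a ! i mod 2})"

definition admissible_ii :: "int list \<Rightarrow> (nat \<Rightarrow> nat) \<Rightarrow> bool" where
  "admissible_ii a \<sigma> \<longleftrightarrow> (\<forall>s < card (set a).
     card (P_plus a \<sigma> \<inter> block a s) \<le> 1 \<and>
     card (P_minus a \<sigma> \<inter> block a s) + card (P_zero a \<sigma> \<inter> block a s) \<le> 1)"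

definition admissible_iii :: "int list \<Rightarrow> (nat \<Rightarrow> nat) \<Rightarrow> bool" where
  "admissible_iii a \<sigma> \<longleftrightarrow>
     (\<forall>i \<in> P_minus a \<sigma>.
        let S = {a ! j |j. j \<in> P_plus a \<sigma> \<and> a ! j > a ! i \<and> a ! j mod 2 = a ! i mod 2}
        in S \<noteq> {} \<and> a ! \<sigma> i = Min S) \<and>
     (\<forall>i \<in> P_plus a \<sigma>.
        let S = {a ! j |j. j \<in> P_minus a \<sigma> \<and> a ! j < a ! i \<and> a ! j mod 2 = a ! i mod 2}
        in S \<noteq> {} \<and> a ! \<sigma> i = Max S)"

definition GK_type :: "int list \<Rightarrow> (nat \<Rightarrow> nat) \<Rightarrow> bool" where
  "GK_type a \<sigma> \<longleftrightarrow> \<sigma> permutes {..<length a} \<and> \<sigma> \<circ> \<sigma> = id \<and>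
     admissible_i a \<sigma> \<and> admissible_ii a \<sigma> \<and> admissible_iii a \<sigma>"

definition standard_GK_type :: "int list \<Rightarrow> (nat \<Rightarrow> nat) \<Rightarrow> bool" where
  "standard_GK_type a \<sigma> \<longleftrightarrow> GK_type a \<sigma> \<and>
     (\<forall>s < card (set a).
        (\<forall>i \<in> (P_zero a \<sigma> \<union> P_minus a \<sigma>) \<inter> block a s. i = Max (block a s)) \<and>
        (\<forall>i \<in> P_plus a \<sigma> \<inter> block a s. i = Min (block a s))) \<and>
     (\<forall>i < length a. a ! i = a ! \<sigma> i \<longrightarrow> \<bar>int (\<sigma> i) - int i\<bar> \<le> 1)"

section \<open>Reduced forms\<close>

definition reduced_form :: "int list \<Rightarrow> (nat \<Rightarrow> nat) \<Rightarrow> 'a::nonarch_local_field mat \<Rightarrow> bool" where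
  "reduced_form a \<sigma> B \<longleftrightarrow> GK_type a \<sigma> \<and> B \<in> M_set a \<and>
     (\<forall>i j. i < length a \<and> i \<notin> P_zero a \<sigma> \<and> j = \<sigma> i \<and> a ! i \<le> a ! j \<longrightarrow>
        is_GK (mat_of_rows_list 2 [[B $$ (i, i), B $$ (i, j)], [B $$ (i, j), B $$ (j, j)]])
          [a ! i, a ! j]) \<and>
     (\<forall>i \<in> P_zero a \<sigma>. vord (B $$ (i, i)) = ereal (of_int (a ! i))) \<and>
     (\<forall>i < length a. \<forall>j < length a. j \<noteq> i \<and> j \<noteq> \<sigma> i \<longrightarrow>
        vord (2 * B $$ (i, j)) > ereal (of_int (a ! i + a ! j) / 2))"

end

theory Submission
  imports Defs
begin

text \<open>A basis in which the form is reduced of type \<open>(a, \<sigma>)\<close> filters the lattice by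
  \<open>Fil c = {x. 2 ord x\<^sub>i + a\<^sub>i \<ge> c for all i}\<close>. The polar form induced on \<open>Fil c / Fil (c + 1)\<close> over
  the residue field pairs the \<open>i\<close>-th basis vector with the \<open>\<sigma> i\<close>-th one only. By admissibility its
  radical is at most one-dimensional, and the quadratic form does not vanish on it. This
  characterises \<open>Fil (c + 1)\<close> inside \<open>Fil c\<close> up to the choice of the basis, so by induction equivalent
  reduced forms with the same \<open>a\<close> have the same filtration. The blocks containing a fixed point
  of \<open>\<sigma>\<close> or an element of \<open>P_minus\<close> are those whose basis vectors contribute to a radical, hence they
  are invariants of the form; the sizes of the blocks and standardness then determine \<open>\<sigma>\<close>.\<close>

text \<open>The orbits \<open>{x, f x}\<close> have two elements and are removed one at a time.
  Applied to negation on residue classes and to a GK involution inside one block.\<close>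

lemma even_card_fixfree_involution:
  assumes "finite A" "\<And>x. x \<in> A \<Longrightarrow> f x \<in> A" "\<And>x. x \<in> A \<Longrightarrow> f (f x) = x"
    "\<And>x. x \<in> A \<Longrightarrow> f x \<noteq> x"
  shows "even (card A)"
  using assms
proof (induction A rule: finite_psubset_induct)
  case (psubset A)
  show ?case
  proof (cases "A = {}")
    case False
    then obtain x where x: "x \<in> A" by blast
    have "even (card (A - {x, f x}))"
    proof (rule psubset.IH)
      fix y assume "y \<in> A - {x, f x}"
      then show "f y \<in> A - {x, f x}" using psubset.prems x
        by (metis DiffD1 DiffD2 DiffI insert_iff singletonD)
    qed (use x psubset.prems in auto)
    moreover have "card A = card (A - {x, f x}) + card {x, f x}"
      using x psubset.prems(1) psubset.hyps
      by (metis card_Diff_subset card_mono empty_subsetI finite.emptyI finite_insert insert_subset le_add_diff_inverse2)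
    moreover have "card {x, f x} = 2" using x psubset.prems(3) by (metis card_2_iff)
    ultimately show ?thesis by simp
  qed simp
qed

section \<open>Half-integral bounds for the valuation\<close>

text \<open>At \<open>0\<close> the choice is unspecified, since \<open>vord 0\<close> is infinite;
  zero is therefore always treated separately.\<close>

definition val :: "'a::discretely_valued_field \<Rightarrow> int" where
  "val x = (SOME k. vord x = ereal (of_int k))"

lemma vord_val: "x \<noteq> 0 \<Longrightarrow> vord x = ereal (of_int (val x))"
  unfolding val_def using someI_ex[OF vord_int] by blast

text \<open>\<open>ord_ge m x\<close> says that \<open>ord x \<ge> m / 2\<close>, and \<open>ord_eq m x\<close> that \<open>ord x = m / 2\<close>. Doubling turns
  the bounds \<open>(a\<^sub>i + a\<^sub>j) / 2\<close> into integers.\<close>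

definition ord_ge :: "int \<Rightarrow> 'a::discretely_valued_field \<Rightarrow> bool" where
  "ord_ge m x \<longleftrightarrow> x = 0 \<or> m \<le> 2 * val x"

definition ord_eq :: "int \<Rightarrow> 'a::discretely_valued_field \<Rightarrow> bool" where
  "ord_eq m x \<longleftrightarrow> ord_ge m x \<and> \<not> ord_ge (m + 1) x"

lemma ord_eq_iff: "ord_eq m x \<longleftrightarrow> x \<noteq> 0 \<and> 2 * val x = m"
  by (auto simp: ord_eq_def ord_ge_def)

lemma val_mult:
  fixes x y :: "'a::discretely_valued_field"
  assumes "x \<noteq> 0" "y \<noteq> 0"
  shows "val (x * y) = val x + val y"
proof -
  have "ereal (of_int (val (x * y))) = ereal (of_int (val x)) + ereal (of_int (val y))"
    using assms vord_mult[of x y] by (simp add: vord_val)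
  then show ?thesis by (simp flip: of_int_add)
qed

lemma val_one [simp]: "val (1 :: 'a::discretely_valued_field) = 0"
  using val_mult[of "1::'a" 1] by simp

lemma val_uminus [simp]: "val (- x) = val (x :: 'a::discretely_valued_field)"
proof (cases "x = 0")
  case False
  have "val (-1 :: 'a) = 0" using val_mult[of "-1::'a" "-1"] by simp
  then show ?thesis using val_mult[of "-1" x] False by simp
qed simp

lemma val_add:
  fixes x y :: "'a::discretely_valued_field"
  assumes "x \<noteq> 0" "y \<noteq> 0" "x + y \<noteq> 0"
  shows "min (val x) (val y) \<le> val (x + y)"
proof -
  have "min (ereal (of_int (val x))) (ereal (of_int (val y))) \<le> ereal (of_int (val (x + y)))"
    using assms vord_add[of x y] by (simp add: vord_val)
  then show ?thesis by (auto simp: min_def split: if_splits)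
qed

lemma ord_ge_0 [simp]: "ord_ge m 0"
  by (simp add: ord_ge_def)

lemma ord_ge_mono: "ord_ge m x \<Longrightarrow> k \<le> m \<Longrightarrow> ord_ge k x"
  by (auto simp: ord_ge_def)

lemma ord_ge_mult: "ord_ge m x \<Longrightarrow> ord_ge k y \<Longrightarrow> ord_ge (m + k) (x * y)"
  by (cases "x = 0 \<or> y = 0") (auto simp: ord_ge_def val_mult)

lemma ord_ge_mult3: "ord_ge m x \<Longrightarrow> ord_ge k y \<Longrightarrow> ord_ge l z \<Longrightarrow> ord_ge (m + k + l) (x * y * z)"
  by (intro ord_ge_mult)

lemma ord_ge_uminus [simp]: "ord_ge m (- x) \<longleftrightarrow> ord_ge m x"
  by (simp add: ord_ge_def)

lemma ord_ge_add: "ord_ge m x \<Longrightarrow> ord_ge m y \<Longrightarrow> ord_ge m (x + y)"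
  by (cases "x = 0 \<or> y = 0 \<or> x + y = 0") (use val_add[of x y] in \<open>auto simp: ord_ge_def\<close>)

lemma ord_ge_diff: "ord_ge m x \<Longrightarrow> ord_ge m y \<Longrightarrow> ord_ge m (x - y)"
  using ord_ge_add[of m x "- y"] by simp

lemma ord_ge_sum: "(\<And>i. i \<in> A \<Longrightarrow> ord_ge m (f i)) \<Longrightarrow> ord_ge m (sum f A)"
  by (induction A rule: infinite_finite_induct) (auto intro: ord_ge_add)

lemma ord_ge_one: "ord_ge 0 1"
  by (simp add: ord_ge_def)

lemma ord_ge_numeral_two: "ord_ge 0 2"
  using ord_ge_add[OF ord_ge_one ord_ge_one] by simp

lemma ord_ge_power: "ord_ge 0 x \<Longrightarrow> ord_ge 0 (x ^ k)"
  using ord_ge_mult[of 0 x 0] by (induction k) (auto simp: ord_ge_one)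

text \<open>Doubled orders are even, so an odd lower bound can be raised by one.\<close>

lemma ord_ge_round: "ord_ge (2 * k + 1) x \<Longrightarrow> ord_ge (2 * (k + 1)) x"
proof -
  have "2 * k + 1 \<le> 2 * v \<Longrightarrow> 2 * (k + 1) \<le> 2 * v" for v :: int by presburger
  then show "ord_ge (2 * k + 1) x \<Longrightarrow> ord_ge (2 * (k + 1)) x" unfolding ord_ge_def by blast
qed

lemma ord_eq_mult: "ord_eq m x \<Longrightarrow> ord_eq k y \<Longrightarrow> ord_eq (m + k) (x * y)"
  by (auto simp: ord_eq_iff val_mult)

lemma ord_eq_mult3: "ord_eq m x \<Longrightarrow> ord_eq k y \<Longrightarrow> ord_eq l z \<Longrightarrow> ord_eq (m + k + l) (x * y * z)"
  by (intro ord_eq_mult)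

lemma ord_ge_iff_vord: "ord_ge m x \<longleftrightarrow> ereal (of_int m / 2) \<le> vord x"
proof (cases "x = 0")
  case False
  have "m \<le> 2 * val x \<longleftrightarrow> (of_int m :: real) \<le> of_int (2 * val x)" by (simp only: of_int_le_iff)
  then show ?thesis using False by (auto simp: ord_ge_def vord_val)
qed (simp add: vord_zero)

lemma ord_ge_Suc_iff_vord: "ord_ge (m + 1) x \<longleftrightarrow> ereal (of_int m / 2) < vord x"
proof (cases "x = 0")
  case False
  have "m + 1 \<le> 2 * val x \<longleftrightarrow> (of_int m :: real) < of_int (2 * val x)" by (simp only: of_int_less_iff) arith
  then show ?thesis using False by (auto simp: ord_ge_def vord_val)
qed (simp add: vord_zero)

lemma valuation_ring_iff: "x \<in> valuation_ring \<longleftrightarrow> ord_ge 0 x"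
  by (simp add: valuation_ring_def ord_ge_iff_vord flip: zero_ereal_def)

lemma maximal_ideal_iff: "x \<in> maximal_ideal \<longleftrightarrow> ord_ge 1 x"
  using ord_ge_Suc_iff_vord[of 0 x] by (simp add: maximal_ideal_def flip: zero_ereal_def)

lemma obtain_uniformizer_power:
  fixes h :: nat
  obtains t :: "'a::discretely_valued_field" where "ord_eq (2 * int h) t"
proof -
  obtain p :: 'a where "vord p = 1" using vord_normalized by blast
  then have "p \<noteq> 0" using vord_zero[where 'a='a] by auto
  then have p: "ord_eq 2 p"
    using vord_val[of p] \<open>vord p = 1\<close> by (simp add: ord_eq_iff one_ereal_def)
  have "ord_eq (2 * int h) (p ^ h)"
  proof (induction h)
    case (Suc h)
    then show ?case using ord_eq_mult[OF p Suc] by (simp add: algebra_simps)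
  qed (simp add: ord_eq_iff)
  then show ?thesis using that by blast
qed

section \<open>The residue field of a dyadic field\<close>

definition res_class :: "'a::nonarch_local_field \<Rightarrow> 'a set" where
  "res_class x = {(x, y). x \<in> valuation_ring \<and> y \<in> valuation_ring \<and> x - y \<in> maximal_ideal} `` {x}"

lemma residue_field_eq: "residue_field = res_class ` {x. ord_ge 0 x}"
  by (auto simp: residue_field_def quotient_def res_class_def valuation_ring_iff)

lemma res_class_eq_iff:
  assumes "ord_ge 0 x" "ord_ge 0 y"
  shows "res_class x = res_class y \<longleftrightarrow> ord_ge 1 (x - y)"
proof
  assume "res_class x = res_class y"
  moreover have "y \<in> res_class y" using assms
    by (simp add: res_class_def valuation_ring_iff maximal_ideal_iff)
  ultimately show "ord_ge 1 (x - y)" by (auto simp: res_class_def maximal_ideal_iff)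
next
  assume *: "ord_ge 1 (x - y)"
  have "ord_ge 1 (x - z) \<longleftrightarrow> ord_ge 1 (y - z)" for z
    using ord_ge_add[OF *, of "y - z"] ord_ge_diff[OF _ *, of "x - z"] by auto
  then show "res_class x = res_class y" using assms
    by (auto simp: res_class_def valuation_ring_iff maximal_ideal_iff)
qed

text \<open>If \<open>2\<close> were a unit, negation would have no fixed point among the nonzero
  residue classes. Their number would be even, and adding the zero class would make \<open>q\<close>
  odd.\<close>

lemma dyadic_two:
  assumes "dyadic TYPE('a::nonarch_local_field)"
  shows "ord_ge 2 (2::'a)"
proof (rule ccontr)
  assume "\<not> ord_ge 2 (2::'a)"
  then have two: "ord_eq 0 (2::'a)"
    using ord_ge_numeral_two[where 'a='a] by (auto simp: ord_eq_iff ord_ge_def)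
  let ?K = "residue_field :: 'a set set"
  \<comment> \<open>Negation on residue classes through a chosen representative; the next fact shows
    independence of the choice.\<close>
  define f where "f C = res_class (- (SOME x. ord_ge 0 x \<and> C = res_class x))" for C :: "'a set"
  have f: "f (res_class x) = res_class (- x)" if "ord_ge 0 x" for x :: 'a
  proof -
    define y where "y = (SOME y. ord_ge 0 y \<and> res_class x = res_class y)"
    have "ord_ge 0 y \<and> res_class x = res_class y"
      unfolding y_def by (rule someI[of _ x]) (simp add: that)
    then have "ord_ge 0 y" "ord_ge 1 (x - y)" using res_class_eq_iff that by auto
    then have "res_class (- y) = res_class (- x)" using that by (subst res_class_eq_iff) auto
    then show ?thesis unfolding f_def y_def by simp
  qed
  have "even (card (?K - {res_class 0}))"
  proof (rule even_card_fixfree_involution[of _ f])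
    show "finite (?K - {res_class 0})" using finite_residue_field by simp
  next
    fix C assume C: "C \<in> ?K - {res_class 0}"
    then obtain x :: 'a where x: "ord_ge 0 x" "C = res_class x" and "res_class x \<noteq> res_class 0"
      by (auto simp: residue_field_eq)
    then have nx: "\<not> ord_ge 1 x" by (simp add: res_class_eq_iff)
    show "f C \<in> ?K - {res_class 0}" using x nx
      by (auto simp: f residue_field_eq res_class_eq_iff)
    show "f (f C) = C" using x by (simp add: f)
    have "ord_eq 0 (2 * x)" using ord_eq_mult[OF two, of 0 x] x nx by (simp add: ord_eq_def)
    then have "\<not> ord_ge 1 (2 * x)" by (simp add: ord_eq_def)
    then have "\<not> ord_ge 1 (- x - x)" by (metis ord_ge_uminus minus_add_distrib mult_2 uminus_add_conv_diff diff_conv_add_uminus)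
    then show "f C \<noteq> C" using x by (simp add: f res_class_eq_iff)
  qed
  moreover have "res_class 0 \<in> ?K" by (auto simp: residue_field_eq)
  then have "card ?K = Suc (card (?K - {res_class 0}))"
    using finite_residue_field by (metis card_Suc_Diff1)
  ultimately show False using assms by (simp add: dyadic_def)
qed

text \<open>Squaring is injective modulo the maximal ideal, so the pigeonhole principle applied to the
  powers \<open>u\<^bsup>2^k\<^esup>\<close> gives \<open>u \<equiv> u\<^bsup>2^d\<^esup>\<close> for some \<open>d > 0\<close>.\<close>

lemma residue_square_root:
  fixes u :: "'a::nonarch_local_field"
  assumes two: "ord_ge 2 (2::'a)" and u: "ord_ge 0 u"
  obtains x where "ord_ge 0 x" "ord_ge 1 (x ^ 2 - u)"
proof -
  \<comment> \<open>Modulo \<open>2\<close>, which lies in the maximal ideal,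
    \<open>x ^ 2 - y ^ 2\<close> agrees with the square of \<open>x - y\<close>.\<close>
  have sq: "ord_ge 1 (x - y)" if "ord_ge 0 x" "ord_ge 0 y" "ord_ge 1 (x ^ 2 - y ^ 2)" for x y :: 'a
  proof -
    have "ord_ge (2 + (0 + 0)) (2 * (y * (y - x)))"
      using that by (intro ord_ge_mult two ord_ge_diff)
    then have "ord_ge 1 ((x ^ 2 - y ^ 2) + 2 * (y * (y - x)))"
      using that by (intro ord_ge_add) (auto intro: ord_ge_mono)
    also have "(x ^ 2 - y ^ 2) + 2 * (y * (y - x)) = (x - y) * (x - y)"
      by (simp add: algebra_simps power2_eq_square)
    finally show ?thesis by (cases "x = y") (use val_mult[of "x - y" "x - y"] in \<open>auto simp: ord_ge_def\<close>)
  qed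
  define w where "w k = u ^ (2 ^ k)" for k :: nat
  have w: "ord_ge 0 (w k)" for k unfolding w_def by (rule ord_ge_power[OF u])
  have wS: "w (Suc k) = w k ^ 2" for k by (simp add: w_def mult.commute flip: power_mult)
  have "\<not> inj (\<lambda>k. res_class (w k))"
  proof
    assume "inj (\<lambda>k. res_class (w k))"
    moreover have "range (\<lambda>k. res_class (w k)) \<subseteq> residue_field" using w by (auto simp: residue_field_eq)
    ultimately show False
      using finite_residue_field finite_subset finite_imageD infinite_UNIV_nat by metis
  qed
  then obtain k d where "res_class (w k) = res_class (w (k + Suc d))"
    unfolding inj_def by (metis less_imp_Suc_add linorder_neqE_nat add_Suc_right)
  then have "ord_ge 1 (w k - w (k + Suc d))" by (simp add: res_class_eq_iff w)
  \<comment> \<open>Injectivity of squaring cancels the first \<open>k\<close> squarings on both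
    sides. This leaves \<open>u\<close> congruent to \<open>w (Suc d) = w d ^ 2\<close>, so
    \<open>w d\<close> is the root sought.\<close>
  then have "ord_ge 1 (w 0 - w (0 + Suc d))"
  proof (induction k)
    case (Suc k)
    then show ?case using sq[OF w w, of k "k + Suc d"] by (simp add: wS)
  qed simp
  then have "ord_ge 1 (w d ^ 2 - u)"
    by (metis add_0 minus_diff_eq ord_ge_uminus power_0 power_one_right w_def wS)
  then show ?thesis using that w by blast
qed

section \<open>The filtration attached to a reduced form\<close>

lemma double_sum_symmetric:
  fixes f :: "nat \<Rightarrow> nat \<Rightarrow> 'b::comm_monoid_add"
  shows "(\<Sum>i<n. \<Sum>j<n. f i j) = (\<Sum>i<n. f i i) + (\<Sum>j<n. \<Sum>i<j. f i j + f j i)"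
proof (induction n)
  case (Suc n)
  have "(\<Sum>i<Suc n. \<Sum>j<Suc n. f i j) = (\<Sum>i<n. \<Sum>j<n. f i j) + (f n n + (\<Sum>i<n. f i n + f n i))"
    by (simp add: sum.distrib add.assoc add.left_commute add.commute[of "f n n"])
  then show ?case by (simp add: Suc.IH add.assoc add.left_commute)
qed simp

text \<open>For symmetric \<open>B\<close> this is the polar form
  \<open>q (x + y) - q x - q y\<close> of \<open>q = quad B\<close>. The factor 2 produces the
  entries \<open>2 * B $$ (i, j)\<close> that \<open>M_set\<close> bounds.\<close>

definition bil :: "'a::comm_ring_1 mat \<Rightarrow> 'a vec \<Rightarrow> 'a vec \<Rightarrow> 'a" where
  "bil B x y = 2 * (x \<bullet> (B *\<^sub>v y))"

definition quad :: "'a::comm_ring_1 mat \<Rightarrow> 'a vec \<Rightarrow> 'a" where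
  "quad B x = x \<bullet> (B *\<^sub>v x)"

lemma scalar_prod_mult_mat_vec:
  assumes "B \<in> carrier_mat n n" "x \<in> carrier_vec n" "y \<in> carrier_vec n"
  shows "x \<bullet> (B *\<^sub>v y) = (\<Sum>i<n. \<Sum>j<n. x $ i * B $$ (i, j) * y $ j)"
  using assms
  by (auto simp: scalar_prod_def sum_distrib_left mult.assoc lessThan_atLeast0 intro!: sum.cong)

lemma transpose_mult_mat_vec_scalar_prod:
  fixes U :: "'a::comm_semiring_0 mat"
  assumes U: "U \<in> carrier_mat n n" and x: "x \<in> carrier_vec n" and w: "w \<in> carrier_vec n"
  shows "x \<bullet> (transpose_mat U *\<^sub>v w) = (U *\<^sub>v x) \<bullet> w"
proof -
  have "x \<bullet> (transpose_mat U *\<^sub>v w) = (transpose_mat U *\<^sub>v w) \<bullet> x"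
    using assms by (intro comm_scalar_prod[of _ n]) auto
  also have "\<dots> = w \<bullet> (U *\<^sub>v x)" using assms by (intro transpose_vec_mult_scalar) auto
  also have "\<dots> = (U *\<^sub>v x) \<bullet> w" using assms by (intro comm_scalar_prod[of _ n]) auto
  finally show ?thesis .
qed

lemma scalar_prod_form_act:
  assumes B: "B \<in> carrier_mat n n" and U: "U \<in> carrier_mat n n"
    and x: "x \<in> carrier_vec n" and y: "y \<in> carrier_vec n"
  shows "x \<bullet> (form_act B U *\<^sub>v y) = (U *\<^sub>v x) \<bullet> (B *\<^sub>v (U *\<^sub>v y))"
proof -
  have "form_act B U *\<^sub>v y = (transpose_mat U * B) *\<^sub>v (U *\<^sub>v y)"
    using assms unfolding form_act_def by (intro assoc_mult_mat_vec) auto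
  also have "\<dots> = transpose_mat U *\<^sub>v (B *\<^sub>v (U *\<^sub>v y))"
    using assms by (intro assoc_mult_mat_vec) auto
  finally show ?thesis
    using transpose_mult_mat_vec_scalar_prod[OF U x, of "B *\<^sub>v (U *\<^sub>v y)"] assms by simp
qed

text \<open>Integrality is a separate requirement: for \<open>c < a ! i\<close> the second bound
  alone can admit coordinates of negative order.\<close>

definition Fil :: "int list \<Rightarrow> int \<Rightarrow> 'a::nonarch_local_field vec set" where
  "Fil a c = {x \<in> carrier_vec (length a).
     \<forall>i<length a. ord_ge 0 (x $ i) \<and> ord_ge (c - a ! i) (x $ i)}"

lemma Fil_mono: "x \<in> Fil a c \<Longrightarrow> d \<le> c \<Longrightarrow> x \<in> Fil a d"
  by (force simp: Fil_def intro: ord_ge_mono)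

lemma Fil_carrier: "x \<in> Fil a c \<Longrightarrow> x \<in> carrier_vec (length a)"
  by (simp add: Fil_def)

text \<open>The lower bounds shared by the members of \<open>M_set a\<close> over a dyadic field, in
  doubled orders. They already bound both forms on the filtration.\<close>

locale filtered_form =
  fixes a :: "int list" and B :: "'a::nonarch_local_field mat"
  assumes two: "ord_ge 2 (2::'a)"
    and carrier: "B \<in> carrier_mat (length a) (length a)"
    and sym: "i < length a \<Longrightarrow> j < length a \<Longrightarrow> B $$ (i, j) = B $$ (j, i)"
    and diag: "i < length a \<Longrightarrow> ord_ge (2 * a ! i) (B $$ (i, i))"
    and off: "i < length a \<Longrightarrow> j < length a \<Longrightarrow> i \<noteq> j \<Longrightarrow> ord_ge (a ! i + a ! j) (2 * B $$ (i, j))"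
begin

lemma bil_sum:
  assumes "x \<in> carrier_vec (length a)" "y \<in> carrier_vec (length a)"
  shows "bil B x y = (\<Sum>i<length a. \<Sum>j<length a. x $ i * y $ j * (2 * B $$ (i, j)))"
  unfolding bil_def scalar_prod_mult_mat_vec[OF carrier assms] sum_distrib_left
  by (simp add: ac_simps)

lemma quad_sum:
  assumes "x \<in> carrier_vec (length a)"
  shows "quad B x = (\<Sum>i<length a. x $ i * x $ i * B $$ (i, i)) +
    (\<Sum>j<length a. \<Sum>i<j. x $ i * x $ j * (2 * B $$ (i, j)))"
  unfolding quad_def scalar_prod_mult_mat_vec[OF carrier assms assms] double_sum_symmetric
proof (intro arg_cong2[of _ _ _ _ "(+)"] sum.cong refl)
  fix i j assume "j \<in> {..<length a}" "i \<in> {..<j}"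
  then have "B $$ (j, i) = B $$ (i, j)" by (intro sym) auto
  then show "x $ i * B $$ (i, j) * x $ j + x $ j * B $$ (j, i) * x $ i = x $ i * x $ j * (2 * B $$ (i, j))"
    by (simp add: algebra_simps)
qed (simp add: ac_simps)

text \<open>The weights cancel in each summand:
  \<open>(c - a ! i) + (d - a ! j) + (a ! i + a ! j) = c + d\<close>.\<close>

lemma bil_bound:
  assumes x: "x \<in> Fil a c" and y: "y \<in> Fil a d"
  shows "ord_ge (c + d) (bil B x y)"
  unfolding bil_sum[OF x[THEN Fil_carrier] y[THEN Fil_carrier]]
proof (intro ord_ge_sum)
  fix i j assume ij: "i \<in> {..<length a}" "j \<in> {..<length a}"
  have "ord_ge (a ! i + a ! j) (2 * B $$ (i, j))"
  proof (cases "i = j")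
    case True
    then show ?thesis using ord_ge_mult[OF two diag[of i]] ij by (auto intro: ord_ge_mono)
  qed (use ij off in auto)
  then have "ord_ge ((c - a ! i) + (d - a ! j) + (a ! i + a ! j)) (x $ i * y $ j * (2 * B $$ (i, j)))"
    using x y ij by (intro ord_ge_mult3) (auto simp: Fil_def)
  then show "ord_ge (c + d) (x $ i * y $ j * (2 * B $$ (i, j)))" by simp
qed

lemma quad_bound:
  assumes x: "x \<in> Fil a c"
  shows "ord_ge (2 * c) (quad B x)"
  unfolding quad_sum[OF x[THEN Fil_carrier]]
proof (intro ord_ge_add ord_ge_sum)
  fix i assume "i \<in> {..<length a}"
  then have "ord_ge ((c - a ! i) + (c - a ! i) + 2 * a ! i) (x $ i * x $ i * B $$ (i, i))"
    using x diag by (intro ord_ge_mult3) (auto simp: Fil_def)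
  then show "ord_ge (2 * c) (x $ i * x $ i * B $$ (i, i))" by simp
next
  fix i j assume "j \<in> {..<length a}" "i \<in> {..<j}"
  then have "ord_ge ((c - a ! i) + (c - a ! j) + (a ! i + a ! j)) (x $ i * x $ j * (2 * B $$ (i, j)))"
    using x off by (intro ord_ge_mult3) (auto simp: Fil_def)
  then show "ord_ge (2 * c) (x $ i * x $ j * (2 * B $$ (i, j)))" by simp
qed

end

text \<open>A reduced form expressed by orders of single entries, with no Gross-Keating invariant
  left. Call \<open>i\<close> with \<open>a ! i \<le> c\<close> open at level \<open>c\<close> if it
  is fixed or its partner lies above \<open>c\<close>; \<open>radical_unique\<close> allows at most
  one open index per parity class.\<close>

locale reduced_data = filtered_form +
  fixes \<sigma> :: "nat \<Rightarrow> nat"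
  assumes \<sigma>_less: "i < length a \<Longrightarrow> \<sigma> i < length a"
    and \<sigma>_invol: "\<sigma> (\<sigma> i) = i"
    and \<sigma>_parity: "i < length a \<Longrightarrow> \<sigma> i \<noteq> i \<Longrightarrow> even (a ! i - a ! \<sigma> i)"
    and off_strict: "i < length a \<Longrightarrow> j < length a \<Longrightarrow> j \<noteq> i \<Longrightarrow> j \<noteq> \<sigma> i \<Longrightarrow>
      ord_ge (a ! i + a ! j + 1) (2 * B $$ (i, j))"
    and pair_exact: "i < length a \<Longrightarrow> \<sigma> i \<noteq> i \<Longrightarrow> ord_eq (a ! i + a ! \<sigma> i) (2 * B $$ (i, \<sigma> i))"
    and diag_exact: "i < length a \<Longrightarrow> \<sigma> i = i \<or> a ! i < a ! \<sigma> i \<Longrightarrow> ord_eq (2 * a ! i) (B $$ (i, i))"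
    and radical_unique: "i < length a \<Longrightarrow> j < length a \<Longrightarrow> even (a ! i - a ! j) \<Longrightarrow>
      a ! i \<le> c \<Longrightarrow> a ! j \<le> c \<Longrightarrow> \<sigma> i = i \<or> c < a ! \<sigma> i \<Longrightarrow> \<sigma> j = j \<or> c < a ! \<sigma> j \<Longrightarrow> i = j"
begin

text \<open>A coordinate that misses the next level meets its bound exactly, and doubled orders are
  even. Hence all leading coordinates sit at weights of the parity of \<open>c\<close>.\<close>

lemma leading_parity:
  assumes x: "x \<in> Fil a c" and i: "i < length a" and lead: "\<not> ord_ge (c - a ! i + 1) (x $ i)"
  shows "ord_eq (c - a ! i) (x $ i)" "even (c - a ! i)" "a ! i \<le> c"
proof -
  show *: "ord_eq (c - a ! i) (x $ i)" using x i lead by (auto simp: ord_eq_def Fil_def)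
  then show "even (c - a ! i)" unfolding ord_eq_iff by (metis dvd_triv_left)
  have "ord_ge 0 (x $ i)" using x i by (simp add: Fil_def)
  with * show "a ! i \<le> c" by (auto simp: ord_eq_iff ord_ge_def)
qed

text \<open>The leading part of \<open>x\<close> lies in the radical of the polar form on the graded piece of degree
  \<open>c\<close>; this radical is spanned by the basis vectors whose partner lies outside the piece.\<close>

lemma radical_support:
  assumes x: "x \<in> Fil a c" and orth: "\<And>y. y \<in> Fil a c \<Longrightarrow> ord_ge (2 * c + 1) (bil B x y)"
    and i: "i < length a" and lead: "\<not> ord_ge (c - a ! i + 1) (x $ i)"
  shows "\<sigma> i = i \<or> c < a ! \<sigma> i"
proof (rule ccontr)
  assume "\<not> ?thesis"
  then have ne: "\<sigma> i \<noteq> i" and le: "a ! \<sigma> i \<le> c" by auto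
  define j where "j = \<sigma> i"
  have j: "j < length a" using \<sigma>_less[OF i] by (simp add: j_def)
  \<comment> \<open>With the partner at or below level \<open>c\<close>, this makes
    \<open>c - a ! j\<close> the doubled order of a power of a prime element.\<close>
  have "even (c - a ! j)"
    using leading_parity(2)[OF x i lead] \<sigma>_parity[OF i ne] unfolding j_def by presburger
  define h where "h = nat ((c - a ! j) div 2)"
  have h: "2 * int h = c - a ! j" using le \<open>even (c - a ! j)\<close> by (simp add: h_def j_def)
  obtain t :: 'a where t: "ord_eq (c - a ! j) t" using obtain_uniformizer_power[of h] h by metis
  \<comment> \<open>This multiple of the partner basis vector just reaches level \<open>c\<close>;
    pairing with it isolates the summand of \<open>i\<close>.\<close>
  define y where "y = vec (length a) (\<lambda>k. if k = j then t else 0)"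
  have y: "y \<in> Fil a c" using t h by (auto simp: y_def Fil_def ord_eq_def intro: ord_ge_mono)
  have "bil B x y = (\<Sum>k<length a. \<Sum>l<length a. if l = j then x $ k * t * (2 * B $$ (k, j)) else 0)"
    unfolding bil_sum[OF x[THEN Fil_carrier] y[THEN Fil_carrier]]
    by (intro sum.cong refl) (auto simp: y_def)
  also have "\<dots> = (\<Sum>k<length a. x $ k * t * (2 * B $$ (k, j)))" using j by simp
  also have "\<dots> = x $ i * t * (2 * B $$ (i, j)) + (\<Sum>k\<in>{..<length a} - {i}. x $ k * t * (2 * B $$ (k, j)))"
    using i by (simp add: sum.remove[of _ i])
  finally have eq: "x $ i * t * (2 * B $$ (i, j)) =
      bil B x y - (\<Sum>k\<in>{..<length a} - {i}. x $ k * t * (2 * B $$ (k, j)))"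
    by simp
  have "ord_ge (2 * c + 1) (\<Sum>k\<in>{..<length a} - {i}. x $ k * t * (2 * B $$ (k, j)))"
  proof (rule ord_ge_sum)
    fix k assume k: "k \<in> {..<length a} - {i}"
    \<comment> \<open>At \<open>k = j\<close> the extra order comes from \<open>2\<close>; for other
      \<open>k\<close>, \<open>j = \<sigma> k\<close> would force \<open>k = i\<close>.\<close>
    have "ord_ge (a ! k + a ! j + 1) (2 * B $$ (k, j))"
    proof (cases "k = j")
      case True
      then show ?thesis using ord_ge_mult[OF two diag[OF j]] by (auto intro: ord_ge_mono)
    next
      case False
      moreover have "j \<noteq> \<sigma> k" using k \<sigma>_invol unfolding j_def by (metis DiffE singletonI)
      ultimately show ?thesis using off_strict[of k j] k j by auto
    qed
    then have "ord_ge ((c - a ! k) + (c - a ! j) + (a ! k + a ! j + 1)) (x $ k * t * (2 * B $$ (k, j)))"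
      using x t k by (intro ord_ge_mult3) (auto simp: Fil_def ord_eq_def)
    then show "ord_ge (2 * c + 1) (x $ k * t * (2 * B $$ (k, j)))" by (simp add: algebra_simps)
  qed
  then have "ord_ge (2 * c + 1) (x $ i * t * (2 * B $$ (i, j)))"
    unfolding eq by (intro ord_ge_diff orth y)
  \<comment> \<open>The total is exactly \<open>2 * c\<close>, one short of the bound just
    obtained.\<close>
  moreover have "ord_eq ((c - a ! i) + (c - a ! j) + (a ! i + a ! j)) (x $ i * t * (2 * B $$ (i, j)))"
    using leading_parity(1)[OF x i lead] t pair_exact[OF i ne] unfolding j_def by (intro ord_eq_mult3)
  ultimately show False by (simp add: ord_eq_def)
qed

text \<open>That radical is at most one-dimensional, and the quadratic form does not vanish on it.\<close>

lemma Fil_step: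
  assumes x: "x \<in> Fil a c" and orth: "\<And>y. y \<in> Fil a c \<Longrightarrow> ord_ge (2 * c + 1) (bil B x y)"
    and quad: "ord_ge (2 * c + 1) (quad B x)"
  shows "x \<in> Fil a (c + 1)"
proof (rule ccontr)
  assume "x \<notin> Fil a (c + 1)"
  then obtain i where i: "i < length a" and lead: "\<not> ord_ge (c - a ! i + 1) (x $ i)"
    using x by (auto simp: Fil_def algebra_simps)
  note lead_i = leading_parity[OF x i lead] radical_support[OF x orth i lead]
  \<comment> \<open>A second leading index would be open at level \<open>c\<close> with the parity
    of \<open>a ! i\<close>, against \<open>radical_unique\<close>.\<close>
  have rest: "ord_ge (c - a ! k + 1) (x $ k)" if k: "k < length a" "k \<noteq> i" for k
  proof (rule ccontr)
    assume lead': "\<not> ?thesis"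
    note lead_k = leading_parity[OF x k(1) lead'] radical_support[OF x orth k(1) lead']
    have "even (a ! k - a ! i)" using lead_i(2) lead_k(2) by presburger
    with radical_unique[OF k(1) i] lead_i lead_k k show False by blast
  qed
  have "ord_ge (2 * c + 1) (\<Sum>k\<in>{..<length a} - {i}. x $ k * x $ k * B $$ (k, k))"
  proof (rule ord_ge_sum)
    fix k assume "k \<in> {..<length a} - {i}"
    then have "ord_ge ((c - a ! k + 1) + (c - a ! k + 1) + 2 * a ! k) (x $ k * x $ k * B $$ (k, k))"
      using rest diag by (intro ord_ge_mult3) auto
    then show "ord_ge (2 * c + 1) (x $ k * x $ k * B $$ (k, k))" by (rule ord_ge_mono) simp
  qed
  moreover have "ord_ge (2 * c + 1) (\<Sum>l<length a. \<Sum>k<l. x $ k * x $ l * (2 * B $$ (k, l)))"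
  proof (intro ord_ge_sum)
    fix k l assume kl: "l \<in> {..<length a}" "k \<in> {..<l}"
    have *: "ord_ge (c - a ! m) (x $ m)" if "m < length a" for m using x that by (auto simp: Fil_def)
    have "ord_ge ((c - a ! k) + (c - a ! l) + 1) (x $ k * x $ l)"
    proof (cases "k = i")
      case True
      then show ?thesis using ord_ge_mult[OF *[of k] rest[of l]] kl by (auto simp: algebra_simps)
    next
      case False
      then show ?thesis using ord_ge_mult[OF rest[of k] *[of l]] kl by (auto simp: algebra_simps)
    qed
    moreover have "ord_ge (a ! k + a ! l) (2 * B $$ (k, l))" using kl by (intro off) auto
    ultimately have "ord_ge (((c - a ! k) + (c - a ! l) + 1) + (a ! k + a ! l)) (x $ k * x $ l * (2 * B $$ (k, l)))"
      by (rule ord_ge_mult)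
    then show "ord_ge (2 * c + 1) (x $ k * x $ l * (2 * B $$ (k, l)))" by (rule ord_ge_mono) simp
  qed
  \<comment> \<open>All other summands reach \<open>2 * c + 1\<close>, so this one must as well. But
    \<open>i\<close> is fixed or lies below its partner, and \<open>diag_exact\<close> gives doubled
    order exactly \<open>2 * c\<close>.\<close>
  moreover have "x $ i * x $ i * B $$ (i, i) = quad B x -
      (\<Sum>k\<in>{..<length a} - {i}. x $ k * x $ k * B $$ (k, k)) -
      (\<Sum>l<length a. \<Sum>k<l. x $ k * x $ l * (2 * B $$ (k, l)))"
    using i by (simp add: quad_sum[OF x[THEN Fil_carrier]] sum.remove[of _ i])
  ultimately have "ord_ge (2 * c + 1) (x $ i * x $ i * B $$ (i, i))"
    using quad by (auto intro: ord_ge_diff)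
  moreover have "ord_eq ((c - a ! i) + (c - a ! i) + 2 * a ! i) (x $ i * x $ i * B $$ (i, i))"
    using lead_i diag_exact[OF i] by (intro ord_eq_mult3) auto
  ultimately show False by (simp add: ord_eq_def)
qed

text \<open>A converse to \<open>radical_support\<close> for basis vectors, at level
  \<open>a ! i\<close>: the coordinate \<open>i\<close> gains from \<open>2\<close>, the partner
  from its larger weight, and the others from strictness.\<close>

lemma unit_vec_radical:
  assumes i: "i < length a" and rad: "\<sigma> i = i \<or> a ! i < a ! \<sigma> i"
    and y: "y \<in> Fil a (a ! i)"
  shows "ord_ge (2 * a ! i + 1) (bil B (unit_vec (length a) i) y)"
proof -
  have "bil B (unit_vec (length a) i) y =
      (\<Sum>k<length a. if k = i then \<Sum>l<length a. y $ l * (2 * B $$ (i, l)) else 0)"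
    unfolding bil_sum[OF unit_vec_carrier y[THEN Fil_carrier]] using i
    by (intro sum.cong refl) (auto simp: index_unit_vec)
  also have "\<dots> = (\<Sum>l<length a. y $ l * (2 * B $$ (i, l)))" using i by simp
  finally have eq: "bil B (unit_vec (length a) i) y = (\<Sum>l<length a. y $ l * (2 * B $$ (i, l)))" .
  show ?thesis
    unfolding eq
  proof (rule ord_ge_sum)
    fix l assume l: "l \<in> {..<length a}"
    have y0: "ord_ge 0 (y $ l)" and yl: "ord_ge (a ! i - a ! l) (y $ l)"
      using y l by (auto simp: Fil_def)
    consider "l = i" | "l \<noteq> i" "l = \<sigma> i" | "l \<noteq> i" "l \<noteq> \<sigma> i" by blast
    then show "ord_ge (2 * a ! i + 1) (y $ l * (2 * B $$ (i, l)))"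
    proof cases
      case 1
      then show ?thesis
        using ord_ge_mult[OF y0 ord_ge_mult[OF two diag[OF i]]] by (auto intro: ord_ge_mono)
    next
      case 2
      then show ?thesis using ord_ge_mult[OF y0 off[OF i, of l]] l rad by (auto intro: ord_ge_mono)
    next
      case 3
      then show ?thesis using ord_ge_mult[OF yl off_strict[OF i, of l]] l by (auto intro: ord_ge_mono)
    qed
  qed
qed

end

section \<open>Invariance of the filtration under integral equivalence\<close>

lemma integral_mats_mult_vec:
  assumes U: "U \<in> integral_mats n" and w: "w \<in> carrier_vec n"
    and bound: "\<And>k. k < n \<Longrightarrow> ord_ge m (w $ k)" and i: "i < n"
  shows "ord_ge m ((U *\<^sub>v w) $ i)"
proof -
  have "(U *\<^sub>v w) $ i = (\<Sum>k<n. U $$ (i, k) * w $ k)"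
    using U w i by (auto simp: integral_mats_def scalar_prod_def lessThan_atLeast0)
  moreover have "ord_ge m (\<Sum>k<n. U $$ (i, k) * w $ k)"
  proof (rule ord_ge_sum)
    fix k assume "k \<in> {..<n}"
    then have "ord_ge (0 + m) (U $$ (i, k) * w $ k)"
      using U bound i by (intro ord_ge_mult) (auto simp: integral_mats_def valuation_ring_iff)
    then show "ord_ge m (U $$ (i, k) * w $ k)" by simp
  qed
  ultimately show ?thesis by simp
qed

lemma form_act_inverse:
  assumes "B \<in> carrier_mat n n" "U \<in> carrier_mat n n" "V \<in> carrier_mat n n" "U * V = 1\<^sub>m n"
  shows "form_act (form_act B U) V = B"
proof -
  have tr: "transpose_mat V * transpose_mat U = 1\<^sub>m n"
    using assms(2-4) transpose_mult[of U n n V n] by simp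
  have "form_act (form_act B U) V = transpose_mat V * (transpose_mat U * B * (U * V))"
    using assms(1-3) unfolding form_act_def by (simp add: assoc_mult_mat[of _ n n _ n _ n])
  also have "\<dots> = transpose_mat V * (transpose_mat U * B)" using assms by simp
  also have "\<dots> = transpose_mat V * transpose_mat U * B"
    using assms(1-3) by (intro assoc_mult_mat[symmetric]) auto
  finally show ?thesis using assms(1) tr by simp
qed

lemma mult_mat_vec_inverse:
  fixes U :: "'b::semiring_1 mat"
  assumes "U \<in> carrier_mat n n" "V \<in> carrier_mat n n" "U * V = 1\<^sub>m n" "x \<in> carrier_vec n"
  shows "U *\<^sub>v (V *\<^sub>v x) = x"
proof -
  have "U *\<^sub>v (V *\<^sub>v x) = (U * V) *\<^sub>v x"
    using assms by (intro assoc_mult_mat_vec[symmetric]) auto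
  then show ?thesis using assms(3,4) by (simp add: one_mult_mat_vec[of x n])
qed

text \<open>\<open>form_act B U\<close> takes at \<open>x\<close> the values of \<open>B\<close> at
  \<open>U *\<^sub>v x\<close>, and its bounds on \<open>Fil a (c + 1)\<close> are what
  \<open>Fil_step\<close> for \<open>B\<close> asks for. Testing against all of
  \<open>Fil a c\<close> needs \<open>V\<close> to preserve that level.\<close>

lemma Fil_transfer_step:
  assumes red: "reduced_data a B s" and T: "filtered_form a (form_act B U)"
    and U: "U \<in> carrier_mat (length a) (length a)" and V: "V \<in> carrier_mat (length a) (length a)"
    and UV: "U * V = 1\<^sub>m (length a)"
    and IH: "\<And>y. y \<in> Fil a c \<Longrightarrow> U *\<^sub>v y \<in> Fil a c" "\<And>y. y \<in> Fil a c \<Longrightarrow> V *\<^sub>v y \<in> Fil a c"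
    and x: "x \<in> Fil a (c + 1)"
  shows "U *\<^sub>v x \<in> Fil a (c + 1)"
proof -
  interpret B: reduced_data a B s by (rule red)
  interpret T: filtered_form a "form_act B U" by (rule T)
  show ?thesis
  proof (rule B.Fil_step)
    show "U *\<^sub>v x \<in> Fil a c" using IH(1) x Fil_mono[OF x, of c] by simp
  next
    fix y :: "'a vec" assume y: "y \<in> Fil a c"
    have "bil B (U *\<^sub>v x) y = bil B (U *\<^sub>v x) (U *\<^sub>v (V *\<^sub>v y))"
      using mult_mat_vec_inverse[OF U V UV y[THEN Fil_carrier]] by simp
    also have "\<dots> = bil (form_act B U) x (V *\<^sub>v y)"
      unfolding bil_def using scalar_prod_form_act[OF B.carrier U x[THEN Fil_carrier]]
        IH(2)[OF y, THEN Fil_carrier] by simp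
    finally show "ord_ge (2 * c + 1) (bil B (U *\<^sub>v x) y)"
      using T.bil_bound[OF x IH(2)[OF y]] by (simp add: algebra_simps)
  next
    have "quad B (U *\<^sub>v x) = quad (form_act B U) x"
      unfolding quad_def using scalar_prod_form_act[OF B.carrier U x[THEN Fil_carrier] x[THEN Fil_carrier]]
      by simp
    then show "ord_ge (2 * c + 1) (quad B (U *\<^sub>v x))"
      using T.quad_bound[OF x] by (auto intro: ord_ge_mono)
  qed
qed

text \<open>Both matrices go through one induction, since each step for one uses the other at the
  previous level.\<close>

lemma Fil_transfer:
  fixes c :: nat
  assumes B: "reduced_data a B s1" and T: "reduced_data a (form_act B U) s2"
    and U: "U \<in> integral_mats (length a)" and V: "V \<in> integral_mats (length a)"
    and UV: "U * V = 1\<^sub>m (length a)" and VU: "V * U = 1\<^sub>m (length a)"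
    and a: "\<forall>k \<in> set a. 0 \<le> k"
    and x: "x \<in> Fil a (int c)"
  shows "U *\<^sub>v x \<in> Fil a (int c) \<and> V *\<^sub>v x \<in> Fil a (int c)"
  using x
proof (induction c arbitrary: x)
  case 0
  \<comment> \<open>As the weights are nonnegative, level 0 consists of all integral
    vectors.\<close>
  have *: "W *\<^sub>v x \<in> Fil a 0" if "W \<in> integral_mats (length a)" for W
  proof -
    have "ord_ge 0 ((W *\<^sub>v x) $ i)" if "i < length a" for i
      using 0 that \<open>W \<in> integral_mats (length a)\<close>
      by (intro integral_mats_mult_vec[where n="length a"]) (auto simp: Fil_def)
    moreover have "W *\<^sub>v x \<in> carrier_vec (length a)" using that 0
      by (auto simp: Fil_def integral_mats_def)
    moreover have "0 \<le> a ! i" if "i < length a" for i using a that by simp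
    ultimately show ?thesis unfolding Fil_def
      by (auto intro: ord_ge_mono[of 0] simp del: index_mult_mat_vec)
  qed
  show ?case using *[OF U] *[OF V] by simp
next
  case (Suc c)
  have carr: "B \<in> carrier_mat (length a) (length a)" "U \<in> carrier_mat (length a) (length a)"
    "V \<in> carrier_mat (length a) (length a)"
    using B U V by (auto simp: reduced_data_def filtered_form_def integral_mats_def)
  \<comment> \<open>\<open>B\<close> is the transform of \<open>form_act B U\<close> by
    \<open>V\<close>, so the step applies with the roles exchanged.\<close>
  have inv_act: "form_act (form_act B U) V = B" by (rule form_act_inverse[OF carr UV])
  have x: "x \<in> Fil a (int c + 1)" using Suc.prems by (simp add: add.commute)
  have "U *\<^sub>v x \<in> Fil a (int c + 1)"
    using Fil_transfer_step[OF B _ carr(2,3) UV _ _ x] T Suc.IH by (auto simp: reduced_data_def)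
  moreover have "V *\<^sub>v x \<in> Fil a (int c + 1)"
    using Fil_transfer_step[OF T _ carr(3,2) VU _ _ x] B Suc.IH
    unfolding inv_act by (auto simp: reduced_data_def)
  ultimately show ?case by (simp add: add.commute)
qed

text \<open>The basis vector \<open>unit_vec n i\<close>, pulled back by \<open>V\<close>, still
  pairs with its level only in higher order. A unit coordinate of it in the block of
  \<open>a ! i\<close> marks the required index for \<open>s2\<close>.\<close>

lemma radical_block_transfer:
  assumes B: "reduced_data a B s1" and T: "reduced_data a (form_act B U) s2"
    and U: "U \<in> integral_mats (length a)" and V: "V \<in> integral_mats (length a)"
    and UV: "U * V = 1\<^sub>m (length a)" and VU: "V * U = 1\<^sub>m (length a)"
    and a: "\<forall>k \<in> set a. 0 \<le> k"
    and i: "i < length a" and rad: "s1 i = i \<or> a ! i < a ! s1 i"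
  shows "\<exists>j<length a. a ! j = a ! i \<and> (s2 j = j \<or> a ! j < a ! s2 j)"
proof -
  interpret B: reduced_data a B s1 by (rule B)
  interpret T: reduced_data a "form_act B U" s2 by (rule T)
  define n where "n = length a"
  define c where "c = nat (a ! i)"
  have c: "int c = a ! i" using a i by (simp add: c_def)
  have carr: "U \<in> carrier_mat n n" "V \<in> carrier_mat n n"
    using U V by (auto simp: integral_mats_def n_def)
  have tr: "U *\<^sub>v x \<in> Fil a (a ! i) \<and> V *\<^sub>v x \<in> Fil a (a ! i)" if "x \<in> Fil a (a ! i)" for x
    using Fil_transfer[OF B T U V UV VU a, of _ c] that by (simp add: c)
  define e :: "'a vec" where "e = unit_vec n i"
  define x where "x = V *\<^sub>v e"
  have e: "e \<in> Fil a (a ! i)"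
    using i by (auto simp: e_def n_def Fil_def ord_ge_one)
  have x: "x \<in> Fil a (a ! i)" using tr[OF e] by (simp add: x_def)
  have Ux: "U *\<^sub>v x = e"
    unfolding x_def using carr UV by (intro mult_mat_vec_inverse[of _ n]) (auto simp: n_def e_def)
  have orth: "ord_ge (2 * a ! i + 1) (bil (form_act B U) x y)" if y: "y \<in> Fil a (a ! i)" for y
  proof -
    have "bil (form_act B U) x y = bil B e (U *\<^sub>v y)"
      unfolding bil_def Ux[symmetric]
      using scalar_prod_form_act[OF B.carrier carr(1)[unfolded n_def] x[THEN Fil_carrier] y[THEN Fil_carrier]]
      by simp
    then show ?thesis using B.unit_vec_radical[OF i rad] tr[OF y] by (simp add: e_def n_def)
  qed
  \<comment> \<open>Otherwise the part \<open>z\<close> of \<open>x\<close> on weights at least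
    \<open>a ! i\<close> lies one level deeper, and the remainder \<open>w\<close> has coordinates
    of positive order. Then coordinate \<open>i\<close> of \<open>U *\<^sub>v x\<close> would have
    positive order, but it is 1.\<close>
  have "\<exists>j<length a. a ! j = a ! i \<and> \<not> ord_ge 1 (x $ j)"
  proof (rule ccontr)
    assume none: "\<not> ?thesis"
    define z where "z = vec n (\<lambda>k. if a ! k < a ! i then 0 else x $ k)"
    define w where "w = vec n (\<lambda>k. if a ! k < a ! i then x $ k else 0)"
    have xk: "ord_ge 0 (x $ k)" "ord_ge (a ! i - a ! k) (x $ k)" if "k < n" for k
      using x that by (auto simp: Fil_def n_def)
    have "ord_ge (a ! i + 1 - a ! k) (x $ k)" if "k < n" "\<not> a ! k < a ! i" for k
      using none xk(1)[OF that(1)] that by (cases "a ! k = a ! i") (auto simp: n_def intro: ord_ge_mono)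
    then have "z \<in> Fil a (int (Suc c))"
      using xk(1) c by (auto simp: Fil_def z_def n_def add.commute)
    then have "U *\<^sub>v z \<in> Fil a (int (Suc c))"
      using Fil_transfer[OF B T U V UV VU a] by blast
    then have Uz: "ord_ge 1 ((U *\<^sub>v z) $ i)" using i c by (auto simp: Fil_def)
    have Uw: "ord_ge 1 ((U *\<^sub>v w) $ i)"
    proof (rule integral_mats_mult_vec[OF U[folded n_def]])
      fix k assume "k < n"
      then show "ord_ge 1 (w $ k)" using xk(2)[of k] by (auto simp: w_def intro: ord_ge_mono)
    qed (use i in \<open>auto simp: w_def n_def\<close>)
    have "x = z + w" using x by (intro eq_vecI) (auto simp: z_def w_def Fil_def n_def)
    moreover have "U *\<^sub>v (z + w) = U *\<^sub>v z + U *\<^sub>v w"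
      using carr by (intro mult_add_distrib_mat_vec) (auto simp: z_def w_def)
    ultimately have "U *\<^sub>v x = U *\<^sub>v z + U *\<^sub>v w" by metis
    then have "ord_ge 1 (e $ i)"
      using Uz Uw i carr unfolding Ux by (auto simp: n_def intro: ord_ge_add)
    then show False using i by (simp add: e_def n_def ord_ge_def)
  qed
  then obtain j where j: "j < length a" "a ! j = a ! i" "\<not> ord_ge 1 (x $ j)" by blast
  have "s2 j = j \<or> a ! i < a ! s2 j"
    using T.radical_support[OF x orth j(1)] j by simp
  then show ?thesis using j by auto
qed

section \<open>Binary forms with a given Gross--Keating invariant\<close>

abbreviation mat2 :: "'a \<Rightarrow> 'a \<Rightarrow> 'a \<Rightarrow> 'a \<Rightarrow> 'a mat" where
  "mat2 p q r s \<equiv> mat_of_rows_list 2 [[p, q], [r, s]]"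

lemma mat2_carrier: "mat2 p q r s \<in> carrier_mat 2 2"
  by (auto simp: mat_of_rows_list_def)

lemma mat2_index:
  "mat2 p q r s $$ (0, 0) = p" "mat2 p q r s $$ (0, Suc 0) = q"
  "mat2 p q r s $$ (Suc 0, 0) = r" "mat2 p q r s $$ (Suc 0, Suc 0) = s"
  by (simp_all add: mat_of_rows_list_def)

lemma less_2_iff: "(i::nat) < 2 \<longleftrightarrow> i = 0 \<or> i = Suc 0"
  by auto

lemma mat2_eqI:
  assumes "A \<in> carrier_mat 2 2" "A $$ (0, 0) = p" "A $$ (0, Suc 0) = q"
    "A $$ (Suc 0, 0) = r" "A $$ (Suc 0, Suc 0) = s"
  shows "A = mat2 p q r s"
proof (rule eq_matI)
  fix i j assume "i < dim_row (mat2 p q r s)" "j < dim_col (mat2 p q r s)"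
  then have "i < 2" "j < 2" using mat2_carrier[of p q r s] by (auto simp only: carrier_matD)
  then show "A $$ (i, j) = mat2 p q r s $$ (i, j)"
    unfolding less_2_iff by (elim disjE) (simp_all only: assms mat2_index)
qed (simp_all only: carrier_matD[OF assms(1)] carrier_matD[OF mat2_carrier])

lemma mat2_mult:
  "mat2 p q r s * mat2 p' q' r' s' =
     mat2 (p * p' + q * r') (p * q' + q * s') (r * p' + s * r') (r * q' + s * s')"
proof (rule mat2_eqI)
  show "mat2 p q r s * mat2 p' q' r' s' \<in> carrier_mat 2 2"
    using mat2_carrier by (rule mult_carrier_mat) (rule mat2_carrier)
qed (simp_all add: mat_of_rows_list_def scalar_prod_def numeral_2_eq_2)

lemma mat2_transpose: "transpose_mat (mat2 p q r s) = mat2 p r q s"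
  by (rule mat2_eqI) (auto simp: mat_of_rows_list_def)

lemma mat2_one: "1\<^sub>m 2 = mat2 1 0 0 1"
  by (rule mat2_eqI) simp_all

lemma mat2_integral:
  "mat2 p q r s \<in> integral_mats 2 \<longleftrightarrow> ord_ge 0 p \<and> ord_ge 0 q \<and> ord_ge 0 r \<and> ord_ge 0 s"
  by (auto simp: integral_mats_def mat2_carrier less_2_iff mat2_index valuation_ring_iff)

lemma mat2_in_M_set:
  assumes b: "0 \<le> b1" "b1 \<le> b2"
    and "ord_ge (2 * b1) \<alpha>" "ord_ge (2 * b2) \<gamma>" "ord_ge (b1 + b2) (2 * \<beta>)"
  shows "mat2 \<alpha> \<beta> \<beta> \<gamma> \<in> M_set [b1, b2]"
proof -
  define M where "M = mat2 \<alpha> \<beta> \<beta> \<gamma>"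
  have M: "M \<in> carrier_mat 2 2" "transpose_mat M = M"
    "M $$ (0, 0) = \<alpha>" "M $$ (0, Suc 0) = \<beta>" "M $$ (Suc 0, 0) = \<beta>" "M $$ (Suc 0, Suc 0) = \<gamma>"
    by (simp_all only: M_def mat2_carrier mat2_transpose mat2_index)
  have *: "ord_ge 0 \<alpha>" "ord_ge 0 \<gamma>" "ord_ge 0 (2 * \<beta>)" using assms by (auto intro: ord_ge_mono)
  moreover have "ord_ge 0 (2 * \<alpha>)" "ord_ge 0 (2 * \<gamma>)"
    using * ord_ge_mult[OF ord_ge_numeral_two, of 0] by simp_all
  ultimately have "M \<in> half_integral 2"
    using M by (auto simp: half_integral_def less_2_iff valuation_ring_iff)
  moreover have "ereal (of_int b1) \<le> vord \<alpha>" "ereal (of_int b2) \<le> vord \<gamma>"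
    "ereal (of_int (b1 + b2) / 2) \<le> vord (2 * \<beta>)"
    using assms(3-5) unfolding ord_ge_iff_vord by simp_all
  ultimately show ?thesis
    using M unfolding M_set_def M_def[symmetric]
    by (auto simp: less_2_iff numeral_2_eq_2[symmetric])
qed

text \<open>An explicit base change gives a candidate for the invariant, which cannot be
  lexicographically larger. Squaring the determinant makes it its own inverse and admits the swap of
  determinant \<open>-1\<close>.\<close>

lemma is_GK_binary_maximal:
  fixes \<alpha> \<beta> \<gamma> p q r s :: "'a::nonarch_local_field"
  assumes GK: "is_GK (mat2 \<alpha> \<beta> \<beta> \<gamma>) [a1, a2]"
    and int: "ord_ge 0 p" "ord_ge 0 q" "ord_ge 0 r" "ord_ge 0 s"
    and det: "(p * s - q * r) * (p * s - q * r) = 1"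
    and b: "0 \<le> b1" "b1 \<le> b2"
    and b1: "ord_ge (2 * b1) (\<alpha> * p * p + 2 * \<beta> * p * r + \<gamma> * r * r)"
    and b2: "ord_ge (2 * b2) (\<alpha> * q * q + 2 * \<beta> * q * s + \<gamma> * s * s)"
    and b12: "ord_ge (b1 + b2) (2 * (\<alpha> * p * q + \<beta> * (p * s + q * r) + \<gamma> * r * s))"
  shows "b1 < a1 \<or> b1 = a1 \<and> b2 \<le> a2"
proof -
  define d where "d = p * s - q * r"
  have d: "d * d = 1" using det by (simp add: d_def)
  have "ord_ge 0 (p * s - q * r)"
    using ord_ge_mult[OF int(1,4)] ord_ge_mult[OF int(2,3)] by (simp add: ord_ge_diff)
  then have d_int: "ord_ge 0 d" by (simp add: d_def)
  define W where "W = mat2 p q r s"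
  define X where "X = mat2 (d * s) (- (d * q)) (- (d * r)) (d * p)"
  have "W * X = mat2 (d * d) 0 0 (d * d)" "X * W = mat2 (d * d) 0 0 (d * d)"
    unfolding W_def X_def mat2_mult d_def by (simp_all add: algebra_simps)
  then have "W * X = 1\<^sub>m 2" "X * W = 1\<^sub>m 2" by (simp_all add: d mat2_one)
  moreover have "X \<in> integral_mats 2" "W \<in> integral_mats 2"
    using int ord_ge_mult[OF d_int] by (force simp: X_def W_def mat2_integral)+
  ultimately have W: "W \<in> GL_o 2" unfolding GL_o_def by blast
  let ?A = "\<alpha> * p * p + 2 * \<beta> * p * r + \<gamma> * r * r"
  let ?B = "\<alpha> * p * q + \<beta> * (p * s + q * r) + \<gamma> * r * s"
  let ?C = "\<alpha> * q * q + 2 * \<beta> * q * s + \<gamma> * s * s"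
  have act: "form_act (mat2 \<alpha> \<beta> \<beta> \<gamma>) W = mat2 ?A ?B ?B ?C"
    unfolding form_act_def W_def mat2_transpose mat2_mult
    by (intro arg_cong[of _ _ "mat_of_rows_list 2"]) (simp add: algebra_simps)
  have "form_act (mat2 \<alpha> \<beta> \<beta> \<gamma>) W \<in> M_set [b1, b2]"
    unfolding act by (rule mat2_in_M_set[OF b b1 b2 b12])
  then have "[b1, b2] \<in> GK_candidates (mat2 \<alpha> \<beta> \<beta> \<gamma>)"
    using b W mat2_carrier[of \<alpha> \<beta> \<beta> \<gamma>] by (auto simp: GK_candidates_def)
  then show ?thesis using GK unfolding is_GK_def by (auto simp: lexord_cons_cons)
qed

text \<open>Each failure of exactness yields a lexicographically larger candidate.\<close>

lemma is_GK_binary_exact: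
  fixes \<alpha> \<beta> \<gamma> :: "'a::nonarch_local_field"
  assumes two: "ord_ge 2 (2::'a)" and GK: "is_GK (mat2 \<alpha> \<beta> \<beta> \<gamma>) [a1, a2]"
    and a: "0 \<le> a1" "a1 \<le> a2" "even (a1 - a2)"
    and \<alpha>: "ord_ge (2 * a1) \<alpha>" and \<gamma>: "ord_ge (2 * a2) \<gamma>" and \<beta>: "ord_ge (a1 + a2) (2 * \<beta>)"
  shows "ord_eq (a1 + a2) (2 * \<beta>) \<and> (a1 < a2 \<longrightarrow> ord_eq (2 * a1) \<alpha>)"
proof
  show lower: "a1 < a2 \<longrightarrow> ord_eq (2 * a1) \<alpha>"
  proof (intro impI, rule ccontr)
    assume lt: "a1 < a2" and "\<not> ord_eq (2 * a1) \<alpha>"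
    then have "ord_ge (2 * (a1 + 1)) \<alpha>" using \<alpha> by (intro ord_ge_round) (auto simp: ord_eq_def)
    \<comment> \<open>Equal parity leaves room for the sorted candidate
      \<open>[a1 + 1, a2 - 1]\<close>.\<close>
    moreover have "a1 + 2 \<le> a2" using lt a(3) by presburger
    moreover have "ord_ge (2 * (a2 - 1)) \<gamma>" using \<gamma> by (rule ord_ge_mono) simp
    moreover have "ord_ge ((a1 + 1) + (a2 - 1)) (2 * \<beta>)" using \<beta> by simp
    ultimately show False
      using is_GK_binary_maximal[OF GK, of 1 0 0 1 "a1 + 1" "a2 - 1"] a by (simp add: ord_ge_one)
  qed
  show "ord_eq (a1 + a2) (2 * \<beta>)"
  proof (rule ccontr)
    assume "\<not> ?thesis"
    then have \<beta>': "ord_ge (a1 + a2 + 1) (2 * \<beta>)" using \<beta> by (simp add: ord_eq_def)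
    \<comment> \<open>By \<open>lower\<close>, an inexact \<open>\<alpha>\<close> forces
      \<open>a1 = a2\<close>, and the swap of basis vectors puts it second. Every case aims at
      \<open>[a1, a2 + 1]\<close>.\<close>
    consider "ord_ge (2 * a2 + 1) \<gamma>" | "a1 = a2" "ord_ge (2 * a1 + 1) \<alpha>"
      | "ord_eq (2 * a1) \<alpha>" "ord_eq (2 * a2) \<gamma>"
      using lower a(2) \<alpha> \<gamma> by (force simp: ord_eq_def)
    then show False
    proof cases
      case 1
      then have "ord_ge (2 * (a2 + 1)) \<gamma>" by (intro ord_ge_round) auto
      then show False
        using is_GK_binary_maximal[OF GK, of 1 0 0 1 a1 "a2 + 1"] a \<alpha> \<beta>'
        by (auto simp: ord_ge_one algebra_simps)
    next
      case 2
      then have "ord_ge (2 * (a2 + 1)) \<alpha>" by (intro ord_ge_round) auto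
      then show False
        using is_GK_binary_maximal[OF GK, of 0 1 1 0 a1 "a2 + 1"] a 2 \<gamma> \<beta>'
        by (auto simp: ord_ge_one algebra_simps)
    next
      case 3
      text \<open>Adding a suitable multiple \<open>x * t\<close> of the first basis vector to the second one raises the
        order of the second diagonal entry.\<close>
      obtain t :: 'a where "ord_eq (2 * int (nat ((a2 - a1) div 2))) t"
        by (rule obtain_uniformizer_power)
      then have t: "ord_eq (a2 - a1) t" using a by (simp add: even_two_times_div_two)
      have "ord_eq (2 * a1 + ((a2 - a1) + (a2 - a1))) (\<alpha> * (t * t))"
        using 3 t by (intro ord_eq_mult)
      then have \<alpha>t: "ord_eq (2 * a2) (\<alpha> * (t * t))" by (simp add: algebra_simps)
      \<comment> \<open>Chosen so that \<open>\<alpha> * (t * t) * u\<close> cancels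
        \<open>\<gamma>\<close>. Both \<open>\<alpha> * (t * t)\<close> and \<open>\<gamma>\<close>
        have order \<open>a2\<close>, so \<open>u\<close> is integral and has a square root modulo
        the maximal ideal.\<close>
      define u where "u = - \<gamma> / (\<alpha> * (t * t))"
      have ne: "\<alpha> * (t * t) \<noteq> 0" "\<gamma> \<noteq> 0" using \<alpha>t 3 by (auto simp: ord_eq_iff)
      then have u: "\<alpha> * (t * t) * u = - \<gamma>" "u \<noteq> 0" by (auto simp: u_def)
      have "val (\<alpha> * (t * t)) + val u = val \<gamma>" using val_mult[OF ne(1) u(2)] u(1) by simp
      then have "ord_ge 0 u" using \<alpha>t 3 by (simp add: ord_eq_iff ord_ge_def)
      then obtain x where x: "ord_ge 0 x" "ord_ge 1 (x ^ 2 - u)"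
        by (rule residue_square_root[OF two])
      have xt: "ord_ge (a2 - a1) (x * t)"
        using ord_ge_mult[OF x(1), of "a2 - a1" t] t by (simp add: ord_eq_def)
      have "ord_ge (2 * a2 + 1) (\<alpha> * (t * t) * (x ^ 2 - u))"
        using \<alpha>t x by (intro ord_ge_mult) (auto simp: ord_eq_def)
      moreover have "ord_ge ((a2 - a1) + (a1 + a2 + 1)) (x * t * (2 * \<beta>))"
        by (intro ord_ge_mult xt \<beta>')
      ultimately have "ord_ge (2 * a2 + 1) (\<alpha> * (t * t) * (x ^ 2 - u) + x * t * (2 * \<beta>))"
        by (intro ord_ge_add) (auto simp: algebra_simps)
      also have "\<alpha> * (t * t) * (x ^ 2 - u) + x * t * (2 * \<beta>) =
          \<alpha> * (x * t) * (x * t) + 2 * \<beta> * (x * t) - \<alpha> * (t * t) * u"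
        by (simp add: algebra_simps power2_eq_square)
      finally have "ord_ge (2 * (a2 + 1)) (\<alpha> * (x * t) * (x * t) + 2 * \<beta> * (x * t) + \<gamma>)"
        unfolding u(1) by (intro ord_ge_round) auto
      \<comment> \<open>The base change adds this term to \<open>2 * \<beta>\<close>; its factor
        \<open>2\<close> lifts it past \<open>a1 + a2 + 1\<close>.\<close>
      moreover have "ord_ge (2 + 2 * a1 + (a2 - a1)) (2 * \<alpha> * (x * t))"
        by (intro ord_ge_mult3 two \<alpha> xt)
      then have "ord_ge (a1 + (a2 + 1)) (2 * \<alpha> * (x * t) + 2 * \<beta>)"
        using \<beta>' by (intro ord_ge_add) (auto intro: ord_ge_mono)
      ultimately show False
        using is_GK_binary_maximal[OF GK, of 1 "x * t" 0 1 a1 "a2 + 1"] a \<alpha> ord_ge_mono[OF xt, of 0]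
        by (auto simp: ord_ge_one algebra_simps)
    qed
  qed
qed

section \<open>Combinatorics of standard GK types\<close>

lemma block_of:
  assumes "i < length a"
  obtains s where "s < card (set a)" "block a s = {j. j < length a \<and> a ! j = a ! i}"
proof -
  have "a ! i \<in> set (sorted_list_of_set (set a))" using assms by simp
  then obtain s where "s < length (sorted_list_of_set (set a))" "sorted_list_of_set (set a) ! s = a ! i"
    by (metis in_set_conv_nth)
  then show ?thesis using that[of s] by (simp add: block_def)
qed

section \<open>Fixed points, lower indices (\<open>P_minus\<close>) and upper indices
  (\<open>P_plus\<close>) of one GK type\<close>

lemma finite_P: "finite (P_plus a \<sigma>)" "finite (P_minus a \<sigma>)" "finite (P_zero a \<sigma>)"
  by (simp_all add: P_plus_def P_minus_def P_zero_def)

context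
  fixes a :: "int list" and \<sigma> :: "nat \<Rightarrow> nat"
  assumes GK: "GK_type a \<sigma>"
begin

lemma GK_type_involution: "\<sigma> (\<sigma> i) = i"
  using GK by (metis GK_type_def comp_apply id_apply)

lemma GK_type_less: "\<sigma> i < length a \<longleftrightarrow> i < length a"
  using GK permutes_in_image[of \<sigma> "{..<length a}" i] by (simp add: GK_type_def)

lemma P_plus_unique:
  assumes "i \<in> P_plus a \<sigma>" "j \<in> P_plus a \<sigma>" "a ! i = a ! j"
  shows "i = j"
proof -
  obtain s where s: "s < card (set a)" "block a s = {k. k < length a \<and> a ! k = a ! i}"
    using assms(1) block_of[of i a] by (auto simp: P_plus_def)
  then have "card (P_plus a \<sigma> \<inter> block a s) \<le> 1"
    using GK by (auto simp: GK_type_def admissible_ii_def)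
  moreover have "i \<in> P_plus a \<sigma> \<inter> block a s" "j \<in> P_plus a \<sigma> \<inter> block a s"
    using assms s by (auto simp: P_plus_def)
  ultimately show ?thesis using finite_P by (metis card_le_Suc0_iff_eq finite_Int One_nat_def)
qed

lemma P_zero_minus_unique:
  assumes "i \<in> P_zero a \<sigma> \<union> P_minus a \<sigma>" "j \<in> P_zero a \<sigma> \<union> P_minus a \<sigma>" "a ! i = a ! j"
  shows "i = j"
proof -
  obtain s where s: "s < card (set a)" "block a s = {k. k < length a \<and> a ! k = a ! i}"
    using assms(1) block_of[of i a] by (auto simp: P_zero_def P_minus_def)
  let ?N = "(P_zero a \<sigma> \<union> P_minus a \<sigma>) \<inter> block a s"
  have "card (P_minus a \<sigma> \<inter> block a s) + card (P_zero a \<sigma> \<inter> block a s) \<le> 1"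
    using GK s by (auto simp: GK_type_def admissible_ii_def)
  moreover have "card ?N \<le> card (P_zero a \<sigma> \<inter> block a s) + card (P_minus a \<sigma> \<inter> block a s)"
    unfolding Int_Un_distrib2 by (rule card_Un_le)
  ultimately have "card ?N \<le> 1" by simp
  moreover have "i \<in> ?N" "j \<in> ?N"
    using assms s by (auto simp: P_zero_def P_minus_def)
  moreover have "finite ?N" using finite_P by simp
  ultimately show ?thesis by (metis card_le_Suc0_iff_eq One_nat_def)
qed

lemma P_minus_partner:
  assumes "i \<in> P_minus a \<sigma>"
  shows "\<sigma> i \<in> P_plus a \<sigma>" "a ! \<sigma> i mod 2 = a ! i mod 2" "a ! i < a ! \<sigma> i"
    "\<And>j. j \<in> P_plus a \<sigma> \<Longrightarrow> a ! i < a ! j \<Longrightarrow> a ! j mod 2 = a ! i mod 2 \<Longrightarrow> a ! \<sigma> i \<le> a ! j"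
proof -
  let ?S = "{a ! j |j. j \<in> P_plus a \<sigma> \<and> a ! j > a ! i \<and> a ! j mod 2 = a ! i mod 2}"
  have fin: "finite ?S" using finite_P(1) by simp
  have S: "?S \<noteq> {}" "a ! \<sigma> i = Min ?S"
    using GK assms by (auto simp: GK_type_def admissible_iii_def Let_def)
  then have "a ! \<sigma> i \<in> ?S" using Min_in[OF fin] by simp
  then show "a ! \<sigma> i mod 2 = a ! i mod 2" "a ! i < a ! \<sigma> i" by auto
  then show "\<sigma> i \<in> P_plus a \<sigma>"
    using assms by (auto simp: P_plus_def P_minus_def GK_type_less GK_type_involution)
  show "a ! \<sigma> i \<le> a ! j" if "j \<in> P_plus a \<sigma>" "a ! i < a ! j" "a ! j mod 2 = a ! i mod 2" for j
    unfolding S(2) using that by (intro Min_le fin) auto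
qed

lemma P_plus_partner:
  assumes "i \<in> P_plus a \<sigma>"
  shows "\<sigma> i \<in> P_minus a \<sigma>" "a ! \<sigma> i mod 2 = a ! i mod 2" "a ! \<sigma> i < a ! i"
    "\<And>j. j \<in> P_minus a \<sigma> \<Longrightarrow> a ! j < a ! i \<Longrightarrow> a ! j mod 2 = a ! i mod 2 \<Longrightarrow> a ! j \<le> a ! \<sigma> i"
proof -
  let ?S = "{a ! j |j. j \<in> P_minus a \<sigma> \<and> a ! j < a ! i \<and> a ! j mod 2 = a ! i mod 2}"
  have fin: "finite ?S" using finite_P(2) by simp
  have S: "?S \<noteq> {}" "a ! \<sigma> i = Max ?S"
    using GK assms by (auto simp: GK_type_def admissible_iii_def Let_def)
  then have "a ! \<sigma> i \<in> ?S" using Max_in[OF fin] by simp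
  then show "a ! \<sigma> i mod 2 = a ! i mod 2" "a ! \<sigma> i < a ! i" by auto
  then show "\<sigma> i \<in> P_minus a \<sigma>"
    using assms by (auto simp: P_plus_def P_minus_def GK_type_less GK_type_involution)
  show "a ! j \<le> a ! \<sigma> i" if "j \<in> P_minus a \<sigma>" "a ! j < a ! i" "a ! j mod 2 = a ! i mod 2" for j
    unfolding S(2) using that by (intro Max_ge fin) auto
qed

lemma P_zero_maximal:
  assumes "i \<in> P_zero a \<sigma>" "j \<in> P_plus a \<sigma>" "a ! j mod 2 = a ! i mod 2"
  shows "a ! j \<le> a ! i"
proof -
  let ?S = "{a ! j |j. j \<in> P_zero a \<sigma> \<union> P_plus a \<sigma> \<and> a ! j mod 2 = a ! i mod 2}"
  have "finite ?S" using finite_P by simp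
  moreover have "a ! j \<in> ?S" using assms by blast
  ultimately have "a ! j \<le> Max ?S" by (rule Max_ge)
  also have "Max ?S = a ! i" using GK assms(1) by (auto simp: GK_type_def admissible_i_def)
  finally show ?thesis .
qed

text \<open>A lower index has its partner above it in its parity class, while no upper index of that
  parity exceeds a fixed point. So \<open>P_plus\<close> and the union determine the fixed
  points.\<close>

lemma P_zero_iff:
  "i \<in> P_zero a \<sigma> \<longleftrightarrow> i \<in> P_zero a \<sigma> \<union> P_minus a \<sigma> \<and>
     (\<forall>j \<in> P_plus a \<sigma>. a ! j mod 2 = a ! i mod 2 \<longrightarrow> a ! j \<le> a ! i)"
proof
  assume *: "i \<in> P_zero a \<sigma> \<union> P_minus a \<sigma> \<and>
    (\<forall>j \<in> P_plus a \<sigma>. a ! j mod 2 = a ! i mod 2 \<longrightarrow> a ! j \<le> a ! i)"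
  then have "i \<notin> P_minus a \<sigma>" using P_minus_partner(1-3)[of i] linorder_not_less by blast
  with * show "i \<in> P_zero a \<sigma>" by blast
qed (use P_zero_maximal[of i] in blast)

lemma partner_parity:
  assumes "i < length a"
  shows "even (a ! i - a ! \<sigma> i)"
proof -
  consider "a ! i = a ! \<sigma> i" | "i \<in> P_minus a \<sigma>" | "i \<in> P_plus a \<sigma>"
    using assms by (force simp: P_minus_def P_plus_def)
  then show ?thesis
    by cases (auto dest: P_minus_partner(2) P_plus_partner(2) simp: mod_eq_dvd_iff dvd_diff_commute)
qed

text \<open>Within a parity class, elements of \<open>P_minus\<close> and \<open>P_plus\<close> alternate, so at every level at most
  one element is still waiting for its partner.\<close>

lemma open_element_unique:
  assumes i: "i < length a" and j: "j < length a" and par: "even (a ! i - a ! j)"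
    and le: "a ! i \<le> c" "a ! j \<le> c"
    and oi: "\<sigma> i = i \<or> c < a ! \<sigma> i" and oj: "\<sigma> j = j \<or> c < a ! \<sigma> j"
  shows "i = j"
proof -
  have mod: "a ! i mod 2 = a ! j mod 2" using par by (simp add: mod_eq_dvd_iff)
  have kinds: "k \<in> P_zero a \<sigma> \<or> k \<in> P_minus a \<sigma> \<and> c < a ! \<sigma> k"
    if "k < length a" "a ! k \<le> c" "\<sigma> k = k \<or> c < a ! \<sigma> k" for k
    using that by (auto simp: P_zero_def P_minus_def)
  \<comment> \<open>The partner of \<open>l\<close> would be an upper index of the same parity above
    \<open>a ! k\<close>.\<close>
  have zero_minus: False
    if "k \<in> P_zero a \<sigma>" "l \<in> P_minus a \<sigma>" "c < a ! \<sigma> l" "a ! k \<le> c" "a ! k mod 2 = a ! l mod 2" for k l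
    using P_zero_maximal[OF that(1) P_minus_partner(1)[OF that(2)]] P_minus_partner(2)[OF that(2)] that
    by simp
  \<comment> \<open>If \<open>a ! k < a ! l\<close>, then \<open>l\<close> would be a closer partner
    for \<open>\<sigma> k\<close> than \<open>k\<close> is.\<close>
  have minus_minus: "\<not> a ! k < a ! l"
    if "k \<in> P_minus a \<sigma>" "c < a ! \<sigma> k" "l \<in> P_minus a \<sigma>" "a ! l \<le> c" "a ! k mod 2 = a ! l mod 2" for k l
    using P_plus_partner(4)[OF P_minus_partner(1)[OF that(1)] that(3)] P_minus_partner(2)[OF that(1)] that
    by (simp add: GK_type_involution)
  consider "i \<in> P_zero a \<sigma>" "j \<in> P_zero a \<sigma>"
    | "i \<in> P_zero a \<sigma>" "j \<in> P_minus a \<sigma>" "c < a ! \<sigma> j"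
    | "j \<in> P_zero a \<sigma>" "i \<in> P_minus a \<sigma>" "c < a ! \<sigma> i"
    | "i \<in> P_minus a \<sigma>" "c < a ! \<sigma> i" "j \<in> P_minus a \<sigma>" "c < a ! \<sigma> j"
    using kinds[OF i le(1) oi] kinds[OF j le(2) oj] by blast
  then show ?thesis
  proof cases
    case 1
    then show ?thesis using GK mod by (auto simp: GK_type_def admissible_i_def)
  next
    case 2
    then show ?thesis using zero_minus le mod by blast
  next
    case 3
    then show ?thesis using zero_minus le mod[symmetric] by blast
  next
    case 4
    then have "a ! i = a ! j" using minus_minus[of i j] minus_minus[of j i] le mod by simp
    then show ?thesis using P_zero_minus_unique 4 by blast
  qed
qed

text \<open>\<open>\<sigma>\<close> pairs off the remaining indices of the block without fixed
  points.\<close>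

lemma block_card_parity:
  fixes v :: int
  defines "K \<equiv> {j. j < length a \<and> a ! j = v}"
  shows "even (card K) \<longleftrightarrow> even (card (P_plus a \<sigma> \<inter> K) + card ((P_zero a \<sigma> \<union> P_minus a \<sigma>) \<inter> K))"
proof -
  let ?P = "P_plus a \<sigma> \<inter> K" and ?N = "(P_zero a \<sigma> \<union> P_minus a \<sigma>) \<inter> K"
  have fin: "finite K" by (simp add: K_def)
  have disj: "?P \<inter> ?N = {}" by (auto simp: P_plus_def P_zero_def P_minus_def)
  have rest: "K - (?P \<union> ?N) = {j. j < length a \<and> a ! j = v \<and> a ! \<sigma> j = v \<and> \<sigma> j \<noteq> j}"
    by (auto simp: K_def P_plus_def P_zero_def P_minus_def)
  have "even (card (K - (?P \<union> ?N)))"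
    unfolding rest
    by (rule even_card_fixfree_involution[of _ \<sigma>])
      (auto simp: GK_type_less GK_type_involution)
  moreover have "card K = card (K - (?P \<union> ?N)) + card (?P \<union> ?N)"
    using fin card_mono[OF fin, of "?P \<union> ?N"] card_Diff_subset[of "?P \<union> ?N" K] by auto
  moreover have "card (?P \<union> ?N) = card ?P + card ?N"
    using fin disj by (intro card_Un_disjoint) auto
  ultimately show ?thesis by simp
qed

end

section \<open>Recovery of a standard involution from its fixed and lower indices\<close>

lemma standard_P_plus_subset:
  assumes s1: "standard_GK_type a \<sigma>1" and s2: "standard_GK_type a \<sigma>2"
    and N: "P_zero a \<sigma>1 \<union> P_minus a \<sigma>1 = P_zero a \<sigma>2 \<union> P_minus a \<sigma>2"
  shows "P_plus a \<sigma>1 \<subseteq> P_plus a \<sigma>2"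
proof
  fix i assume i: "i \<in> P_plus a \<sigma>1"
  have GK: "GK_type a \<sigma>1" "GK_type a \<sigma>2" using s1 s2 by (auto simp: standard_GK_type_def)
  let ?K = "{j. j < length a \<and> a ! j = a ! i}"
  have "i < length a" using i by (simp add: P_plus_def)
  then obtain s where s: "s < card (set a)" "block a s = ?K" by (rule block_of)
  have "P_plus a \<sigma>1 \<inter> ?K = {i}" using i \<open>i < length a\<close> P_plus_unique[OF GK(1) _ i] by blast
  then have "odd (card (P_plus a \<sigma>1 \<inter> ?K))" by simp
  \<comment> \<open>The block and its fixed and lower indices are common to both involutions, so the
    parity carries over. Standardness then places the upper index at the minimum of the
    block.\<close>
  then have "odd (card (P_plus a \<sigma>2 \<inter> ?K))"
    using block_card_parity[OF GK(1), of "a ! i"] block_card_parity[OF GK(2), of "a ! i"] N by auto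
  then have "P_plus a \<sigma>2 \<inter> ?K \<noteq> {}" by force
  then obtain j where j: "j \<in> P_plus a \<sigma>2" "j \<in> ?K" by blast
  have "i = Min ?K" "j = Min ?K"
    using s1 s2 s i j \<open>i < length a\<close> by (auto simp: standard_GK_type_def)
  then show "i \<in> P_plus a \<sigma>2" using j(1) by simp
qed

text \<open>Standardness puts such an index at the maximum of its block, so knowing the block is
  enough.\<close>

lemma standard_zero_minus_subset:
  assumes s1: "standard_GK_type a \<sigma>1" and s2: "standard_GK_type a \<sigma>2"
    and blocks: "\<And>i. i \<in> P_zero a \<sigma>1 \<union> P_minus a \<sigma>1 \<Longrightarrow> \<exists>j \<in> P_zero a \<sigma>2 \<union> P_minus a \<sigma>2. a ! j = a ! i"
  shows "P_zero a \<sigma>1 \<union> P_minus a \<sigma>1 \<subseteq> P_zero a \<sigma>2 \<union> P_minus a \<sigma>2"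
proof
  fix i assume i: "i \<in> P_zero a \<sigma>1 \<union> P_minus a \<sigma>1"
  let ?K = "{j. j < length a \<and> a ! j = a ! i}"
  have "i < length a" using i by (auto simp: P_zero_def P_minus_def)
  then obtain s where s: "s < card (set a)" "block a s = ?K" by (rule block_of)
  obtain j where j: "j \<in> P_zero a \<sigma>2 \<union> P_minus a \<sigma>2" "a ! j = a ! i" using blocks[OF i] by blast
  have "i \<in> ?K" "j \<in> ?K" using j \<open>i < length a\<close> by (auto simp: P_zero_def P_minus_def)
  then have "i = Max ?K" "j = Max ?K"
    using s1 s2 s i j(1) unfolding standard_GK_type_def by (metis IntI)+
  then show "i \<in> P_zero a \<sigma>2 \<union> P_minus a \<sigma>2" using j(1) by simp
qed

text \<open>If one map sends \<open>i\<close> to a smaller index, the induction hypothesis there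
  makes the other do the same; otherwise both send \<open>i\<close> to \<open>Suc i\<close>.\<close>

lemma adjacent_involutions_agree:
  fixes f g :: "nat \<Rightarrow> nat"
  assumes "\<And>i. i \<in> R \<Longrightarrow> f i \<in> R \<and> f (f i) = i \<and> f i \<noteq> i \<and> \<bar>int (f i) - int i\<bar> \<le> 1"
    and "\<And>i. i \<in> R \<Longrightarrow> g i \<in> R \<and> g (g i) = i \<and> g i \<noteq> i \<and> \<bar>int (g i) - int i\<bar> \<le> 1"
    and "i \<in> R"
  shows "f i = g i"
  using assms(3)
proof (induction i rule: less_induct)
  case (less i)
  have f: "f i < i \<or> f i = Suc i" and g: "g i < i \<or> g i = Suc i"
    using assms(1,2)[OF less.prems] by linarith+
  show ?case using f g less.IH assms(1,2) less.prems by metis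
qed

text \<open>Parity counts give \<open>P_plus\<close>, and \<open>P_zero_iff\<close> then splits the
  union. Admissibility forces the partners across blocks, adjacency those within a block.\<close>

lemma standard_GK_type_determined:
  assumes s1: "standard_GK_type a \<sigma>1" and s2: "standard_GK_type a \<sigma>2"
    and N: "P_zero a \<sigma>1 \<union> P_minus a \<sigma>1 = P_zero a \<sigma>2 \<union> P_minus a \<sigma>2"
  shows "\<sigma>1 = \<sigma>2"
proof
  fix i
  have GK: "GK_type a \<sigma>1" "GK_type a \<sigma>2" using s1 s2 by (auto simp: standard_GK_type_def)
  have plus: "P_plus a \<sigma>1 = P_plus a \<sigma>2"
    using standard_P_plus_subset[OF s1 s2 N] standard_P_plus_subset[OF s2 s1 N[symmetric]] by blast
  have zero: "P_zero a \<sigma>1 = P_zero a \<sigma>2"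
  proof (rule Set.set_eqI)
    show "k \<in> P_zero a \<sigma>1 \<longleftrightarrow> k \<in> P_zero a \<sigma>2" for k
      by (subst P_zero_iff[OF GK(1)], subst P_zero_iff[OF GK(2)], simp only: N plus)
  qed
  have "P_zero a \<sigma> \<inter> P_minus a \<sigma> = {}" for \<sigma> by (auto simp: P_zero_def P_minus_def)
  then have minus: "P_minus a \<sigma>1 = P_minus a \<sigma>2" using zero N by blast
  \<comment> \<open>The indices with a different partner of equal weight.\<close>
  define R where "R = {..<length a} - (P_zero a \<sigma>1 \<union> P_plus a \<sigma>1 \<union> P_minus a \<sigma>1)"
  have R: "\<sigma> i \<in> R \<and> \<sigma> (\<sigma> i) = i \<and> \<sigma> i \<noteq> i \<and> \<bar>int (\<sigma> i) - int i\<bar> \<le> 1"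
    if st: "standard_GK_type a \<sigma>" and i: "i \<in> R"
      and R': "R = {..<length a} - (P_zero a \<sigma> \<union> P_plus a \<sigma> \<union> P_minus a \<sigma>)" for \<sigma> i
  proof -
    have GK': "GK_type a \<sigma>" using st by (simp add: standard_GK_type_def)
    note inv = GK_type_involution[OF GK'] and less = GK_type_less[OF GK']
    have i': "i < length a" "a ! i = a ! \<sigma> i" "\<sigma> i \<noteq> i"
      using i unfolding R' by (auto simp: P_zero_def P_plus_def P_minus_def)
    moreover have "\<sigma> i \<in> R"
      using i' inv[of i] unfolding R' by (auto simp: P_zero_def P_plus_def P_minus_def less)
    ultimately show ?thesis using st inv[of i] by (simp add: standard_GK_type_def)
  qed
  consider "\<not> i < length a" | "i \<in> P_zero a \<sigma>1" | "i \<in> P_minus a \<sigma>1" | "i \<in> P_plus a \<sigma>1" | "i \<in> R"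
    by (auto simp: R_def)
  then show "\<sigma>1 i = \<sigma>2 i"
  proof cases
    case 1
    then show ?thesis using GK by (auto simp: GK_type_def permutes_def)
  next
    case 2
    moreover from 2 have "i \<in> P_zero a \<sigma>2" by (simp only: zero)
    ultimately show ?thesis by (simp add: P_zero_def)
  next
    case 3
    note p1 = P_minus_partner[OF GK(1) 3] and p2 = P_minus_partner[OF GK(2) 3[unfolded minus]]
    \<comment> \<open>Each of the two partners competes in the minimum defining the other.\<close>
    have "a ! \<sigma>1 i = a ! \<sigma>2 i"
      using p1(4)[of "\<sigma>2 i"] p2(4)[of "\<sigma>1 i"] p1(1-3) p2(1-3) plus by (intro antisym) auto
    then show ?thesis using P_plus_unique[OF GK(1) p1(1)] p2(1) plus by blast
  next
    case 4
    note p1 = P_plus_partner[OF GK(1) 4] and p2 = P_plus_partner[OF GK(2) 4[unfolded plus]]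
    have "a ! \<sigma>1 i = a ! \<sigma>2 i"
      using p1(4)[of "\<sigma>2 i"] p2(4)[of "\<sigma>1 i"] p1(1-3) p2(1-3) minus by (intro antisym) auto
    then show ?thesis using P_zero_minus_unique[OF GK(1), of "\<sigma>1 i" "\<sigma>2 i"] p1(1) p2(1) minus by blast
  next
    case 5
    then show ?thesis
      using adjacent_involutions_agree[of R \<sigma>1 \<sigma>2 i] R[OF s1] R[OF s2] by (simp add: R_def zero plus minus)
  qed
qed

section \<open>Reduced forms of a given type\<close>

text \<open>Admissibility supplies parity and \<open>radical_unique\<close>;
  \<open>is_GK_binary_exact\<close> turns the invariant of each pair into exact orders.\<close>

lemma reduced_form_data:
  fixes B :: "'a::nonarch_local_field mat"
  assumes two: "ord_ge 2 (2::'a)" and a: "\<forall>x \<in> set a. 0 \<le> x" and red: "reduced_form a \<sigma> B"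
  shows "reduced_data a B \<sigma>"
proof -
  have GK: "GK_type a \<sigma>" and M: "B \<in> M_set a" using red by (auto simp: reduced_form_def)
  note inv = GK_type_involution[OF GK] and less = GK_type_less[OF GK]
  have carrier: "B \<in> carrier_mat (length a) (length a)" and tr: "transpose_mat B = B"
    using M by (auto simp: M_set_def half_integral_def)
  have sym: "B $$ (i, j) = B $$ (j, i)" if "i < length a" "j < length a" for i j
    using carrier that index_transpose_mat(1)[of i B j] by (simp add: tr)
  have diag: "ord_ge (2 * a ! i) (B $$ (i, i))" if "i < length a" for i
    using M that by (simp add: M_set_def ord_ge_iff_vord)
  have off_less: "ord_ge (a ! i + a ! j) (2 * B $$ (i, j))" if "i < j" "j < length a" for i j
    using M that by (simp add: M_set_def ord_ge_iff_vord)
  have off: "ord_ge (a ! i + a ! j) (2 * B $$ (i, j))" if "i < length a" "j < length a" "i \<noteq> j" for i j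
    using off_less[of i j] off_less[of j i] sym[of i j] that by (cases "i < j") (simp_all add: add.commute)
  have exact: "ord_eq (a ! i + a ! \<sigma> i) (2 * B $$ (i, \<sigma> i)) \<and>
      (a ! i < a ! \<sigma> i \<longrightarrow> ord_eq (2 * a ! i) (B $$ (i, i)))"
    if i: "i < length a" "\<sigma> i \<noteq> i" "a ! i \<le> a ! \<sigma> i" for i
  proof (rule is_GK_binary_exact[OF two])
    show "is_GK (mat2 (B $$ (i, i)) (B $$ (i, \<sigma> i)) (B $$ (i, \<sigma> i)) (B $$ (\<sigma> i, \<sigma> i))) [a ! i, a ! \<sigma> i]"
      using red i by (simp add: reduced_form_def P_zero_def)
  qed (use a i less partner_parity[OF GK i(1)] diag off in auto)
  show ?thesis
  proof (unfold_locales; (rule two carrier inv)?)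
    fix i assume i: "i < length a" "\<sigma> i \<noteq> i"
    show "ord_eq (a ! i + a ! \<sigma> i) (2 * B $$ (i, \<sigma> i))"
    proof (cases "a ! i \<le> a ! \<sigma> i")
      \<comment> \<open>The fact \<open>exact\<close> starts from the member of smaller weight, here
        the partner.\<close>
      case False
      then show ?thesis
        using exact[of "\<sigma> i"] i less inv[of i] sym[of i "\<sigma> i"] by (simp add: add.commute)
    qed (use exact i in simp)
  next
    fix i assume i: "i < length a" "\<sigma> i = i \<or> a ! i < a ! \<sigma> i"
    show "ord_eq (2 * a ! i) (B $$ (i, i))"
    proof (cases "\<sigma> i = i")
      case True
      then have "vord (B $$ (i, i)) = ereal (of_int (a ! i))"
        using red i by (simp add: reduced_form_def P_zero_def)
      then show ?thesis
        unfolding ord_eq_def ord_ge_Suc_iff_vord unfolding ord_ge_iff_vord by simp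
    qed (use exact i in auto)
  next
    fix i j assume "i < length a" "j < length a" "j \<noteq> i" "j \<noteq> \<sigma> i"
    then show "ord_ge (a ! i + a ! j + 1) (2 * B $$ (i, j))"
      using red by (simp add: reduced_form_def ord_ge_Suc_iff_vord)
  next
    fix i j c assume "i < length a" "j < length a" "even (a ! i - a ! j)" "a ! i \<le> c" "a ! j \<le> c"
      "\<sigma> i = i \<or> c < a ! \<sigma> i" "\<sigma> j = j \<or> c < a ! \<sigma> j"
    then show "i = j" by (rule open_element_unique[OF GK])
  qed (erule sym diag off partner_parity[OF GK] | simp add: less)+
qed

theorem theorem4p2:
  fixes a :: "int list"
    and B T :: "'a::nonarch_local_field mat"
    and \<sigma>1 \<sigma>2 :: "nat \<Rightarrow> nat"
  assumes "dyadic TYPE('a)"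
    and "sorted a" and "\<forall>x \<in> set a. 0 \<le> x"
    and "B \<in> half_integral (length a)" and "T \<in> half_integral (length a)"
    and "standard_GK_type a \<sigma>1" and "reduced_form a \<sigma>1 B"
    and "standard_GK_type a \<sigma>2" and "reduced_form a \<sigma>2 T"
    and "form_equiv B T"
  shows "\<sigma>1 = \<sigma>2"
proof -
  have two: "ord_ge 2 (2::'a)" by (rule dyadic_two) fact
  have B: "reduced_data a B \<sigma>1" and T: "reduced_data a T \<sigma>2"
    using reduced_form_data[OF two] assms by blast+
  have carr: "B \<in> carrier_mat (length a) (length a)"
    using assms(4) by (simp add: half_integral_def)
  then obtain U V where U: "U \<in> integral_mats (length a)" and V: "V \<in> integral_mats (length a)"
    and UV: "U * V = 1\<^sub>m (length a)" and VU: "V * U = 1\<^sub>m (length a)" and act: "T = form_act B U"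
    using assms(10) by (auto simp: form_equiv_def GL_o_def)
  \<comment> \<open>With \<open>B\<close> as the transform of \<open>T\<close> by \<open>V\<close>,
    the reverse inclusion below follows by the same argument.\<close>
  have inv_act: "form_act T V = B"
    unfolding act using carr U V UV by (intro form_act_inverse) (auto simp: integral_mats_def)
  have N: "k \<in> P_zero a \<sigma> \<union> P_minus a \<sigma> \<longleftrightarrow> k < length a \<and> (\<sigma> k = k \<or> a ! k < a ! \<sigma> k)" for k \<sigma>
    by (auto simp: P_zero_def P_minus_def)
  have "P_zero a \<sigma>1 \<union> P_minus a \<sigma>1 \<subseteq> P_zero a \<sigma>2 \<union> P_minus a \<sigma>2"
  proof (rule standard_zero_minus_subset[OF assms(6,8)])
    fix i assume "i \<in> P_zero a \<sigma>1 \<union> P_minus a \<sigma>1"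
    then show "\<exists>j \<in> P_zero a \<sigma>2 \<union> P_minus a \<sigma>2. a ! j = a ! i"
      using radical_block_transfer[OF B T[unfolded act] U V UV VU assms(3), of i]
      unfolding N Bex_def by blast
  qed
  moreover have "P_zero a \<sigma>2 \<union> P_minus a \<sigma>2 \<subseteq> P_zero a \<sigma>1 \<union> P_minus a \<sigma>1"
  proof (rule standard_zero_minus_subset[OF assms(8,6)])
    fix i assume "i \<in> P_zero a \<sigma>2 \<union> P_minus a \<sigma>2"
    then show "\<exists>j \<in> P_zero a \<sigma>1 \<union> P_minus a \<sigma>1. a ! j = a ! i"
      using radical_block_transfer[OF T B[folded inv_act] V U VU UV assms(3), of i]
      unfolding N Bex_def by blast
  qed
  ultimately show ?thesis using standard_GK_type_determined[OF assms(6,8)] by blast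
qed

end
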